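(* Let $F$ be a differential field of characteristic $0$ with subfield of differential constants $C$, and suppose $F=C(W)$, where $W$ is a finite set algebraically independent over $C$. Assume $C=C'(T)$, where $C'$ is any subfield of $\overline{\mathbb{Q}}$ and $T$ is a set, of any cardinality, algebraically independent over $C'$. Let $R=F[X_1,\dots,X_n]$ be a differential polynomial ring over $F$, with quotient field $E$. If $E$ has no new constants, then $R$ has only finitely many height one prime differential ideals.
   Context: All rings are commutative with $1$. A differential ring is a ring with a single derivation $D$. Here "differential polynomial ring $F[X_1,\dots,X_n]$" means the ordinary polynomial ring in the finitely many independent indeterminates $X_1,\dots,X_n$, equipped with some derivation $D$ (so $DX_i\in F[X_1,\dots,X_n]$) extending the derivation of $F$. The derivation extends uniquely to the quotient field $E$. The field of differential constants of $F$ is $C=\{a\in F: Da=0\}$, and "$E$ has no new constants" means $\{e\in E: De=0\}=C$. $\overline{\mathbb{Q}}$ is an algebraic closure of $\mathbb{Q}$. A differential ideal is an ideal $I$ with $D(I)\subseteq I$. *)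

theory Defs
  imports
    "HOL-Algebra.Algebra"
    "HOL-Algebra.Algebraic_Closure_Type"
    "HOL-Library.Poly_Mapping"
    "HOL-Library.Extended_Nat"
begin

text \<open>
  Everything takes place inside the quotient field \<open>E\<close> of the differential polynomial ring. \<open>E\<close> is
  a type of class \<open>field_char_0\<close>; its subfields, subrings and ideals are sets, handled by the
  notions of \<open>HOL-Algebra\<close> applied to the record \<open>ring_of_type_algebra\<close> and its restrictions.
\<close>

abbreviation ring_on :: "'a::ring_1 set \<Rightarrow> 'a ring" where
  "ring_on S \<equiv> ring_of_type_algebra\<lparr>carrier := S\<rparr>"

abbreviation field_adjoin :: "'a::field set \<Rightarrow> 'a set \<Rightarrow> 'a set" where
  "field_adjoin K S \<equiv> generate_field ring_of_type_algebra (K \<union> S)"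

text \<open>
  A polynomial in indeterminates indexed by \<open>'i\<close> is a finitely supported function from monomials
  (finitely supported exponent functions) to coefficients. \<open>mpolys K I\<close> is the set of those with
  coefficients in \<open>K\<close> involving only indeterminates with index in \<open>I\<close>.
\<close>

definition mpolys :: "'a::zero set \<Rightarrow> 'i set \<Rightarrow> (('i \<Rightarrow>\<^sub>0 nat) \<Rightarrow>\<^sub>0 'a) set" where
  "mpolys K I =
     {p. (\<forall>m\<in>Poly_Mapping.keys p. Poly_Mapping.lookup p m \<in> K \<and> Poly_Mapping.keys m \<subseteq> I)}"

definition mpoly_eval :: "('i \<Rightarrow> 'a) \<Rightarrow> (('i \<Rightarrow>\<^sub>0 nat) \<Rightarrow>\<^sub>0 'a) \<Rightarrow> 'a::comm_ring_1" where
  "mpoly_eval x p =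
     (\<Sum>m\<in>Poly_Mapping.keys p.
        Poly_Mapping.lookup p m * (\<Prod>i\<in>Poly_Mapping.keys m. x i ^ Poly_Mapping.lookup m i))"

definition alg_independent :: "'a::comm_ring_1 set \<Rightarrow> 'i set \<Rightarrow> ('i \<Rightarrow> 'a) \<Rightarrow> bool" where
  "alg_independent K I x \<longleftrightarrow> (\<forall>p\<in>mpolys K I. mpoly_eval x p = 0 \<longrightarrow> p = 0)"

abbreviation alg_independent_set :: "'a::comm_ring_1 set \<Rightarrow> 'a set \<Rightarrow> bool" where
  "alg_independent_set K S \<equiv> alg_independent K S (\<lambda>s. s)"

definition ring_adjoin :: "'a::comm_ring_1 set \<Rightarrow> 'i set \<Rightarrow> ('i \<Rightarrow> 'a) \<Rightarrow> 'a set" where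
  "ring_adjoin K I x = mpoly_eval x ` mpolys K I"

text \<open>
  \<open>R\<close> is the polynomial ring \<open>K[x\<^sub>1, \<dots>, x\<^sub>n]\<close>, realised inside the ambient ring: it is generated
  over \<open>K\<close> by \<open>x 1, \<dots>, x n\<close>, and these are independent indeterminates.
\<close>

definition is_polynomial_ring ::
    "'a::comm_ring_1 set \<Rightarrow> 'a set \<Rightarrow> nat \<Rightarrow> (nat \<Rightarrow> 'a) \<Rightarrow> bool" where
  "is_polynomial_ring R K n x \<longleftrightarrow> alg_independent K {1..n} x \<and> R = ring_adjoin K {1..n} x"

definition whole_is_quotient_field_of :: "'a::field set \<Rightarrow> bool" where
  "whole_is_quotient_field_of R \<longleftrightarrow> (\<forall>e. \<exists>a\<in>R. \<exists>b\<in>R. b \<noteq> 0 \<and> e = a / b)"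

definition derivation :: "('a::comm_ring_1 \<Rightarrow> 'a) \<Rightarrow> bool" where
  "derivation D \<longleftrightarrow>
     (\<forall>x y. D (x + y) = D x + D y) \<and> (\<forall>x y. D (x * y) = D x * y + x * D y)"

text \<open>For a subring, this says that \<open>D\<close> restricts to a derivation; for an ideal, that it is differential.\<close>

definition D_stable :: "('a \<Rightarrow> 'a) \<Rightarrow> 'a set \<Rightarrow> bool" where
  "D_stable D S \<longleftrightarrow> D ` S \<subseteq> S"

definition constants :: "('a::zero \<Rightarrow> 'a) \<Rightarrow> 'a set \<Rightarrow> 'a set" where
  "constants D S = {a \<in> S. D a = 0}"

text \<open>Supremum of the lengths \<open>k\<close> of chains \<open>Q 0 \<subset> \<dots> \<subset> Q k = P\<close> of prime ideals of \<open>R\<close>.\<close>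

definition ideal_height :: "('a, 'm) ring_scheme \<Rightarrow> 'a set \<Rightarrow> enat" where
  "ideal_height R P =
     (SUP k\<in>{k. \<exists>Q. (\<forall>i\<le>k. primeideal (Q i) R) \<and> (\<forall>i<k. Q i \<subset> Q (Suc i)) \<and> Q k = P}. enat k)"

end

theory Submission
  imports Defs "HOL-Computational_Algebra.Polynomial"
begin

text \<open>
  The theorem is an instance of Jouanolou's theorem: a derivation \<open>\<delta>\<close> of a rational function field
  over a field \<open>C\<close> that is also the field of constants, mapping the polynomial ring \<open>B\<close> to itself,
  admits only finitely many irreducible polynomials \<open>p\<close>, up to associates, with \<open>p\<close> dividing \<open>\<delta> p\<close>.

  Reduction to that statement. The elements of \<open>W\<close> and the \<open>x i\<close> together are independent
  indeterminates over \<open>C\<close>, and \<open>R\<close> is the localization of \<open>B = C[W, x\<^sub>1, \<dots>, x\<^sub>n]\<close> at the nonzero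
  elements of \<open>C[W]\<close>. Multiplying \<open>D\<close> by a common denominator \<open>g\<close> in \<open>C[W]\<close> gives a derivation
  \<open>\<delta> = g D\<close> that maps \<open>B\<close> to itself and has the same constants. As \<open>B\<close> is factorial
  (\<open>gauss_ufd_polys_over\<close>, \<open>ufd_poly_tower\<close>), a height one prime \<open>P\<close> of \<open>R\<close> is generated by a prime
  element \<open>p\<close> of \<open>B\<close> (\<open>localized_height_one_prime\<close>), and if \<open>P\<close> is differential then \<open>p\<close> divides \<open>\<delta> p\<close>
  in \<open>B\<close>.

  Finiteness (\<open>finitely_many_invariant_primes\<close>). Write \<open>\<delta> p = p k\<^sub>p\<close>. Degrees show that all cofactors
  \<open>k\<^sub>p\<close> lie in one finite-dimensional \<open>C\<close>-space. The differential form \<open>dp / p\<close> is closed and its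
  contraction with \<open>\<delta>\<close> is \<open>k\<^sub>p\<close>; hence its Lie derivative along \<open>\<delta>\<close> is \<open>dk\<^sub>p\<close>. In coordinates this
  says that the logarithmic derivatives of \<open>p\<close>, together with the coefficients of \<open>k\<^sub>p\<close>, form a
  solution of a linear differential system that does not depend on \<open>p\<close>. By the Wronskian argument
  (\<open>linear_differential_system_dependent\<close>), more solutions than the size of the system are linearly
  dependent over the constants, that is, over \<open>C\<close>, because there are no new constants. On the other
  hand, a nontrivial relation with coefficients in \<open>C\<close> between the logarithmic derivatives of
  non-associated primes forces some prime \<open>q\<close> to divide all its partial derivatives
  (\<open>log_derivative_relation_trivial\<close>). Then these vanish, \<open>\<delta> q = 0\<close>, and \<open>q\<close> lies in \<open>C\<close>,
  contradicting that \<open>q\<close> is a prime element.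
\<close>

section \<open>Subrings and prime factorization\<close>

definition subring_set :: "'a::comm_ring_1 set \<Rightarrow> bool" where
  "subring_set A \<longleftrightarrow> 1 \<in> A \<and> (\<forall>a\<in>A. \<forall>b\<in>A. a - b \<in> A \<and> a * b \<in> A)"

lemma subring_setD:
  assumes "subring_set A"
  shows subring_set_one: "1 \<in> A"
    and subring_set_zero: "0 \<in> A"
    and subring_set_diff: "a \<in> A \<Longrightarrow> b \<in> A \<Longrightarrow> a - b \<in> A"
    and subring_set_uminus: "a \<in> A \<Longrightarrow> - a \<in> A"
    and subring_set_add: "a \<in> A \<Longrightarrow> b \<in> A \<Longrightarrow> a + b \<in> A"
    and subring_set_mult: "a \<in> A \<Longrightarrow> b \<in> A \<Longrightarrow> a * b \<in> A"
proof -
  show 1: "1 \<in> A" using assms by (simp add: subring_set_def)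
  show d: "a - b \<in> A" if "a \<in> A" "b \<in> A" for a b
    using assms that by (auto simp: subring_set_def)
  show 0: "0 \<in> A" using d[OF 1 1] by simp
  show u: "- a \<in> A" if "a \<in> A" for a using d[OF 0 that] by simp
  show "a + b \<in> A" if "a \<in> A" "b \<in> A" using d[OF that(1) u[OF that(2)]] by simp
  show "a * b \<in> A" if "a \<in> A" "b \<in> A" using assms that by (auto simp: subring_set_def)
qed

lemma subring_set_sum:
  assumes "subring_set A" and "\<And>i. i \<in> I \<Longrightarrow> f i \<in> A"
  shows "sum f I \<in> A"
  using assms(2)
  by (induction I rule: infinite_finite_induct)
     (auto intro: subring_setD[OF assms(1)])

lemma subring_set_prod:
  assumes "subring_set A" and "\<And>i. i \<in> I \<Longrightarrow> f i \<in> A"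
  shows "prod f I \<in> A"
  using assms(2)
  by (induction I rule: infinite_finite_induct)
     (auto intro: subring_setD[OF assms(1)])

lemma subring_set_power:
  assumes "subring_set A" "a \<in> A"
  shows "a ^ k \<in> A"
  using assms by (induction k) (auto intro: subring_setD)

lemma subring_set_prod_list:
  assumes "subring_set A" "set xs \<subseteq> A"
  shows "prod_list xs \<in> A"
  using assms(2) by (induction xs) (auto intro: subring_setD[OF assms(1)])

definition dvd_in :: "'a::comm_ring_1 set \<Rightarrow> 'a \<Rightarrow> 'a \<Rightarrow> bool" where
  "dvd_in A a b \<longleftrightarrow> (\<exists>c\<in>A. b = a * c)"

definition prime_in :: "'a::comm_ring_1 set \<Rightarrow> 'a \<Rightarrow> bool" where
  "prime_in A p \<longleftrightarrow> p \<in> A \<and> p \<noteq> 0 \<and> \<not> dvd_in A p 1 \<and>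
     (\<forall>a\<in>A. \<forall>b\<in>A. dvd_in A p (a * b) \<longrightarrow> dvd_in A p a \<or> dvd_in A p b)"

definition prime_factorization_in :: "'a::comm_ring_1 set \<Rightarrow> 'a \<Rightarrow> 'a \<Rightarrow> 'a list \<Rightarrow> bool" where
  "prime_factorization_in A a u ps \<longleftrightarrow>
     u \<in> A \<and> dvd_in A u 1 \<and> (\<forall>p\<in>set ps. prime_in A p) \<and> a = u * prod_list ps"

definition ufd_set :: "'a::comm_ring_1 set \<Rightarrow> bool" where
  "ufd_set A \<longleftrightarrow> subring_set A \<and> (\<forall>a\<in>A. a \<noteq> 0 \<longrightarrow> (\<exists>u ps. prime_factorization_in A a u ps))"

lemma dvd_in_trans:
  assumes "subring_set A" "dvd_in A a b" "dvd_in A b c"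
  shows "dvd_in A a c"
proof -
  obtain d e where "d \<in> A" "e \<in> A" "b = a * d" "c = b * e" using assms by (auto simp: dvd_in_def)
  thus ?thesis using subring_set_mult[OF assms(1)] unfolding dvd_in_def
    by (intro bexI[of _ "d * e"]) (auto simp: mult.assoc)
qed

lemma dvd_in_mult:
  assumes "subring_set A" "dvd_in A a b" "c \<in> A"
  shows "dvd_in A a (b * c)"
proof -
  obtain d where "d \<in> A" "b = a * d" using assms by (auto simp: dvd_in_def)
  thus ?thesis using subring_set_mult[OF assms(1)] assms(3) unfolding dvd_in_def
    by (intro bexI[of _ "d * c"]) (auto simp: mult.assoc)
qed

lemma dvd_in_add:
  assumes "subring_set A" "dvd_in A a b" "dvd_in A a c"
  shows "dvd_in A a (b + c)"
proof -
  obtain d e where "d \<in> A" "e \<in> A" "b = a * d" "c = a * e" using assms by (auto simp: dvd_in_def)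
  thus ?thesis using subring_set_add[OF assms(1)] unfolding dvd_in_def
    by (intro bexI[of _ "d + e"]) (auto simp: distrib_left)
qed

lemma dvd_in_minus:
  assumes "subring_set A" "dvd_in A a b"
  shows "dvd_in A a (- b)"
proof -
  obtain d where "d \<in> A" "b = a * d" using assms by (auto simp: dvd_in_def)
  thus ?thesis using subring_set_uminus[OF assms(1)] unfolding dvd_in_def
    by (intro bexI[of _ "- d"]) auto
qed

lemma dvd_in_sum:
  assumes A: "subring_set A" and "\<And>i. i \<in> I \<Longrightarrow> dvd_in A a (f i)"
  shows "dvd_in A a (sum f I)"
proof -
  have "dvd_in A a 0" using subring_set_zero[OF A] by (force simp: dvd_in_def)
  thus ?thesis using assms(2)
    by (induction I rule: infinite_finite_induct) (auto intro: dvd_in_add[OF A])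
qed

lemma dvd_in_triv: "subring_set A \<Longrightarrow> c \<in> A \<Longrightarrow> dvd_in A a (a * c)"
  by (auto simp: dvd_in_def)

lemma dvd_in_refl: "subring_set A \<Longrightarrow> dvd_in A a a"
  using dvd_in_triv[of A 1 a] subring_set_one by auto

lemma prime_inD:
  assumes "prime_in A p"
  shows "p \<in> A" "p \<noteq> 0" "\<not> dvd_in A p 1"
    "\<And>a b. a \<in> A \<Longrightarrow> b \<in> A \<Longrightarrow> dvd_in A p (a * b) \<Longrightarrow> dvd_in A p a \<or> dvd_in A p b"
  using assms by (auto simp: prime_in_def)

lemma prime_factorization_in_mult:
  assumes A: "subring_set A" and "prime_factorization_in A a u ps" "prime_factorization_in A b v qs"
  shows "prime_factorization_in A (a * b) (u * v) (ps @ qs)"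
proof -
  have "dvd_in A (u * v) 1"
  proof -
    obtain c d where cd: "c \<in> A" "d \<in> A" "1 = u * c" "1 = v * d"
      using assms by (auto simp: prime_factorization_in_def dvd_in_def)
    have "1 = (u * c) * (v * d)" using cd(3,4) by (metis mult_1)
    hence "1 = (u * v) * (c * d)" by (simp add: ac_simps)
    thus ?thesis using cd subring_set_mult[OF A] unfolding dvd_in_def by blast
  qed
  thus ?thesis using assms subring_set_mult[OF A]
    by (auto simp: prime_factorization_in_def ac_simps)
qed

text \<open>
  Uniqueness of factorization in the only form needed below: a prime divisor of a product of primes
  is associated to one of the factors. The conclusion is stated as divisibility of the new prime by
  the factor, so that the factor itself can be cancelled from the list.
\<close>

lemma prime_in_dvd_prod_list:
  fixes A :: "'a::idom set"
  assumes A: "subring_set A" and q: "prime_in A q"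
    and a: "prime_factorization_in A a u ps" and dvd: "dvd_in A q a"
  obtains p where "p \<in> set ps" "dvd_in A p q"
proof -
  have u: "u \<in> A" "dvd_in A u 1" and ps: "\<forall>p\<in>set ps. prime_in A p" and a: "a = u * prod_list ps"
    using a by (auto simp: prime_factorization_in_def)
  have psA: "set ps \<subseteq> A" using ps prime_inD(1) by blast
  have "\<not> dvd_in A q u" using u(2) dvd_in_trans[OF A _ u(2)] prime_inD(3)[OF q] by blast
  hence "dvd_in A q (prod_list ps)"
    using dvd a prime_inD(4)[OF q u(1) subring_set_prod_list[OF A psA]] by auto
  hence "\<exists>p\<in>set ps. dvd_in A q p" using psA
  proof (induction ps)
    case Nil
    thus ?case using prime_inD(3)[OF q] by simp
  next
    case (Cons p ps)
    thus ?case
      using prime_inD(4)[OF q, of p "prod_list ps"] subring_set_prod_list[OF A, of ps] by auto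
  qed
  then obtain p where p: "p \<in> set ps" "dvd_in A q p" by blast
  then obtain c where c: "c \<in> A" "p = q * c" by (auto simp: dvd_in_def)
  have pp: "prime_in A p" using p ps by blast
  have "dvd_in A p q \<or> dvd_in A p c"
    using prime_inD(4)[OF pp prime_inD(1)[OF q] c(1)] c(2) dvd_in_refl[OF A] by metis
  moreover have "\<not> dvd_in A p c"
  proof
    assume "dvd_in A p c"
    then obtain d where d: "d \<in> A" "c = p * d" by (auto simp: dvd_in_def)
    have "p * 1 = p * (q * d)" using c(2) d(2) by (metis mult.assoc mult.commute mult_1_right)
    hence "1 = q * d" using prime_inD(2)[OF pp] by (metis mult_left_cancel)
    thus False using prime_inD(3)[OF q] d unfolding dvd_in_def by blast
  qed
  ultimately show ?thesis using that p by blast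
qed

text \<open>
  Kaplansky's observation. \<open>Q\<close> is only required to behave like a prime ideal on the elements of
  \<open>A\<close>, so that the contraction to \<open>A\<close> of a prime ideal of a larger ring can be used without
  naming that contraction.
\<close>

lemma prime_ideal_contains_prime:
  assumes ufd: "ufd_set A" and a: "a \<in> A" "a \<in> Q" "a \<noteq> 0"
    and unit: "\<And>u. u \<in> A \<Longrightarrow> dvd_in A u 1 \<Longrightarrow> u \<notin> Q"
    and prime: "\<And>a b. a \<in> A \<Longrightarrow> b \<in> A \<Longrightarrow> a * b \<in> Q \<Longrightarrow> a \<in> Q \<or> b \<in> Q"
  obtains p where "prime_in A p" "p \<in> Q"
proof -
  have A: "subring_set A" using ufd by (simp add: ufd_set_def)
  obtain u ps where "prime_factorization_in A a u ps" using ufd a by (auto simp: ufd_set_def)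
  hence u: "u \<in> A" "dvd_in A u 1" and ps: "\<forall>p\<in>set ps. prime_in A p" and aeq: "a = u * prod_list ps"
    by (auto simp: prime_factorization_in_def)
  have psA: "set ps \<subseteq> A" using ps prime_inD(1) by blast
  have "prod_list ps \<in> Q"
    using prime[OF u(1) subring_set_prod_list[OF A psA]] a(2) aeq unit[OF u] by blast
  hence "\<exists>p\<in>set ps. p \<in> Q" using psA
  proof (induction ps)
    case Nil
    thus ?case using unit[of 1] subring_set_one[OF A] dvd_in_refl[OF A] by simp
  next
    case (Cons p ps)
    thus ?case using prime[of p "prod_list ps"] subring_set_prod_list[OF A, of ps] by auto
  qed
  thus ?thesis using that ps by blast
qed

section \<open>Factorization in polynomial rings\<close>

definition polys_over :: "'a::comm_ring_1 set \<Rightarrow> 'a poly set" where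
  "polys_over A = {p. \<forall>i. coeff p i \<in> A}"

lemma polys_overD: "p \<in> polys_over A \<Longrightarrow> coeff p i \<in> A"
  by (auto simp: polys_over_def)

lemma const_in_polys_over: "subring_set A \<Longrightarrow> a \<in> A \<Longrightarrow> [:a:] \<in> polys_over A"
  by (auto simp: polys_over_def coeff_pCons subring_set_zero split: nat.splits)

lemma monom_in_polys_over: "subring_set A \<Longrightarrow> a \<in> A \<Longrightarrow> monom a k \<in> polys_over A"
  by (auto simp: polys_over_def subring_set_zero)

lemma subring_polys_over:
  assumes A: "subring_set A"
  shows "subring_set (polys_over A)"
  unfolding subring_set_def
proof (intro conjI ballI)
  show "1 \<in> polys_over A"
    using const_in_polys_over[OF A subring_set_one[OF A]] by (simp add: one_pCons)
  fix p q assume "p \<in> polys_over A" "q \<in> polys_over A"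
  thus "p - q \<in> polys_over A" "p * q \<in> polys_over A"
    by (auto simp: polys_over_def coeff_mult intro!: subring_set_sum[OF A] subring_setD[OF A])
qed

lemma const_dvd_in_polys_over:
  assumes A: "subring_set A"
  shows "dvd_in (polys_over A) [:a:] p \<longleftrightarrow> (\<forall>i. dvd_in A a (coeff p i))"
proof
  assume "dvd_in (polys_over A) [:a:] p"
  thus "\<forall>i. dvd_in A a (coeff p i)" by (auto simp: dvd_in_def polys_over_def)
next
  assume *: "\<forall>i. dvd_in A a (coeff p i)"
  then obtain c where c: "\<And>i. c i \<in> A" "\<And>i. coeff p i = a * c i" unfolding dvd_in_def by metis
  define q where "q = (\<Sum>i\<le>degree p. monom (c i) i)"
  have "q \<in> polys_over A" unfolding q_def
    by (intro subring_set_sum[OF subring_polys_over[OF A]] monom_in_polys_over[OF A] c)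
  moreover have "p = [:a:] * q"
  proof -
    have "[:a:] * q = (\<Sum>i\<le>degree p. monom (coeff p i) i)"
      unfolding q_def sum_distrib_left by (intro sum.cong) (simp_all add: smult_monom c(2))
    thus ?thesis by (simp add: poly_as_sum_of_monoms)
  qed
  ultimately show "dvd_in (polys_over A) [:a:] p" unfolding dvd_in_def by blast
qed

text \<open>
  If \<open>p\<close> divides neither \<open>f\<close> nor \<open>g\<close>, let \<open>i\<close> and \<open>j\<close> be the first indices at which \<open>p\<close> fails to
  divide a coefficient. Every summand of the coefficient of \<open>f * g\<close> at \<open>i + j\<close> other than
  \<open>coeff f i * coeff g j\<close> is divisible by \<open>p\<close>, hence the coefficient itself is not.
\<close>

lemma prime_in_polys_over_const:
  fixes A :: "'a::idom set"
  assumes A: "subring_set A" and p: "prime_in A p"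
  shows "prime_in (polys_over A) [:p:]"
  unfolding prime_in_def
proof (intro conjI ballI impI)
  show "[:p:] \<in> polys_over A" using const_in_polys_over[OF A] prime_inD(1)[OF p] .
  show "[:p:] \<noteq> 0" using prime_inD(2)[OF p] by simp
  show "\<not> dvd_in (polys_over A) [:p:] 1"
  proof
    assume "dvd_in (polys_over A) [:p:] 1"
    hence "dvd_in A p (coeff 1 0)" using const_dvd_in_polys_over[OF A] by blast
    thus False using prime_inD(3)[OF p] by simp
  qed
  fix f g assume f: "f \<in> polys_over A" and g: "g \<in> polys_over A"
    and dvd: "dvd_in (polys_over A) [:p:] (f * g)"
  show "dvd_in (polys_over A) [:p:] f \<or> dvd_in (polys_over A) [:p:] g"
  proof (rule ccontr)
    assume "\<not> ?thesis"
    then obtain i0 j0 where "\<not> dvd_in A p (coeff f i0)" "\<not> dvd_in A p (coeff g j0)"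
      using const_dvd_in_polys_over[OF A] by blast
    then obtain i j where i: "\<not> dvd_in A p (coeff f i)" "\<And>k. k < i \<Longrightarrow> dvd_in A p (coeff f k)"
      and j: "\<not> dvd_in A p (coeff g j)" "\<And>k. k < j \<Longrightarrow> dvd_in A p (coeff g k)"
      using exists_least_iff[of "\<lambda>i. \<not> dvd_in A p (coeff f i)"]
        exists_least_iff[of "\<lambda>i. \<not> dvd_in A p (coeff g i)"] by blast
    have "coeff (f * g) (i + j) = coeff f i * coeff g j +
        (\<Sum>k\<in>{..i+j} - {i}. coeff f k * coeff g (i + j - k))"
      unfolding coeff_mult by (subst sum.remove[of _ i]) auto
    moreover have "dvd_in A p (\<Sum>k\<in>{..i+j} - {i}. coeff f k * coeff g (i + j - k))"
    proof -
      have *: "dvd_in A p (coeff f k * coeff g (i + j - k))" if "k \<in> {..i+j} - {i}" for k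
      proof (cases "k < i")
        case True
        thus ?thesis using dvd_in_mult[OF A i(2)] polys_overD[OF g] by blast
      next
        case False
        hence "i + j - k < j" using that by auto
        thus ?thesis using dvd_in_mult[OF A j(2)] polys_overD[OF f] by (metis mult.commute)
      qed
      show ?thesis by (intro dvd_in_sum[OF A] *)
    qed
    moreover have "dvd_in A p (coeff (f * g) (i + j))"
      using dvd const_dvd_in_polys_over[OF A] by blast
    ultimately have "dvd_in A p (coeff f i * coeff g j)"
      using dvd_in_add[OF A _ dvd_in_minus[OF A], of p]
      by (metis add_diff_cancel_right' diff_conv_add_uminus)
    thus False using prime_inD(4)[OF p polys_overD[OF f] polys_overD[OF g]] i(1) j(1) by blast
  qed
qed

definition primitive_over :: "'a::comm_ring_1 set \<Rightarrow> 'a poly \<Rightarrow> bool" where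
  "primitive_over A g \<longleftrightarrow> (\<forall>p. prime_in A p \<longrightarrow> \<not> dvd_in (polys_over A) [:p:] g)"

lemma prod_list_in_primes:
  assumes "subring_set A" "\<forall>p\<in>set ps. prime_in A p"
  shows "prod_list ps \<in> A"
  using assms prime_inD(1) by (intro subring_set_prod_list) blast+

text \<open>
  The primes of \<open>A\<close> that make up \<open>c\<close> stay prime as constant polynomials and do not divide \<open>g\<close>; so each
  of them divides the cofactor of \<open>g\<close> and can be cancelled.
\<close>

lemma primitive_cancel_const:
  fixes A :: "'a::idom set"
  assumes ufd: "ufd_set A" and g: "g \<in> polys_over A" "primitive_over A g"
    and w: "w \<in> polys_over A" and c: "c \<in> A" "c \<noteq> 0"
    and dvd: "dvd_in (polys_over A) g ([:c:] * w)"
  shows "dvd_in (polys_over A) g w"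
proof -
  let ?S = "polys_over A"
  have A: "subring_set A" using ufd by (simp add: ufd_set_def)
  note S = subring_polys_over[OF A]
  obtain u ps where "prime_factorization_in A c u ps" using ufd c by (auto simp: ufd_set_def)
  hence u: "u \<in> A" "dvd_in A u 1" and ps: "\<forall>p\<in>set ps. prime_in A p" and ceq: "c = u * prod_list ps"
    by (auto simp: prime_factorization_in_def)
  obtain v where v: "v \<in> A" "u * v = 1" using u(2) by (auto simp: dvd_in_def)
  have "dvd_in ?S g ([:c:] * w * [:v:])"
    by (rule dvd_in_mult[OF S dvd const_in_polys_over[OF A v(1)]])
  moreover have "[:c:] * w * [:v:] = smult ((u * v) * prod_list ps) w"
    by (simp add: ceq ac_simps)
  ultimately have "dvd_in ?S g (smult (prod_list ps) w)" using v by simp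
  thus ?thesis using ps
  proof (induction ps)
    case Nil
    thus ?case by simp
  next
    case (Cons p ps)
    have p: "prime_in A p" using Cons.prems by simp
    obtain q where q: "q \<in> ?S" "smult (prod_list (p # ps)) w = g * q"
      using Cons.prems(1) by (auto simp: dvd_in_def)
    have psw: "smult (prod_list ps) w \<in> ?S"
      using subring_set_mult[OF S const_in_polys_over[OF A prod_list_in_primes[OF A]] w, of ps]
        Cons.prems by simp
    have *: "[:p:] * smult (prod_list ps) w = g * q" using q(2) by (simp add: mult.commute)
    hence "dvd_in ?S [:p:] (g * q)" using dvd_in_triv[OF S psw] by metis
    hence "dvd_in ?S [:p:] q"
      using prime_inD(4)[OF prime_in_polys_over_const[OF A p] g(1) q(1)] g(2) p
      by (auto simp: primitive_over_def)
    then obtain r where r: "r \<in> ?S" "q = [:p:] * r" by (auto simp: dvd_in_def)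
    have "[:p:] * smult (prod_list ps) w = [:p:] * (g * r)" using * r(2) by (simp add: ac_simps)
    hence "smult (prod_list ps) w = g * r"
      using prime_inD(2)[OF p] by (metis mult_left_cancel pCons_eq_0_iff)
    thus ?case using Cons.IH Cons.prems r(1) dvd_in_triv[OF S r(1)] by simp
  qed
qed

text \<open>
  A prime of \<open>A\<close> dividing \<open>f\<close> divides the leading coefficient and hence is associated to one of its
  finitely many prime factors. Dividing such factors out of \<open>f\<close> shortens the factorization of the
  leading coefficient, so the process ends.
\<close>

lemma primitive_part_exists:
  fixes A :: "'a::idom set"
  assumes ufd: "ufd_set A" and f: "f \<in> polys_over A" "f \<noteq> 0"
  obtains c g where "c \<in> A" "c \<noteq> 0" "g \<in> polys_over A" "primitive_over A g" "f = [:c:] * g"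
proof -
  let ?S = "polys_over A"
  have A: "subring_set A" using ufd by (simp add: ufd_set_def)
  note S = subring_polys_over[OF A]
  obtain u ps where "prime_factorization_in A (lead_coeff f) u ps"
    using ufd f polys_overD[OF f(1)] unfolding ufd_set_def by (metis leading_coeff_0_iff)
  hence "\<exists>c g. c \<in> A \<and> c \<noteq> 0 \<and> g \<in> ?S \<and> primitive_over A g \<and> f = [:c:] * g"
    using f
  proof (induction "length ps" arbitrary: f ps rule: less_induct)
    case less
    show ?case
    proof (cases "primitive_over A f")
      case True
      thus ?thesis using less.prems subring_set_one[OF A] by (intro exI[of _ 1] exI[of _ f]) auto
    next
      case False
      then obtain q where q: "prime_in A q" "dvd_in ?S [:q:] f" by (auto simp: primitive_over_def)
      have "dvd_in A q (lead_coeff f)" using q(2) const_dvd_in_polys_over[OF A] by blast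
      then obtain p where p: "p \<in> set ps" "dvd_in A p q"
        using prime_in_dvd_prod_list[OF A q(1) less.prems(1)] by blast
      have pp: "prime_in A p" using p less.prems(1) by (auto simp: prime_factorization_in_def)
      have "dvd_in A p (coeff f i)" for i
        using dvd_in_trans[OF A p(2)] q(2) const_dvd_in_polys_over[OF A] by blast
      hence "dvd_in ?S [:p:] f" using const_dvd_in_polys_over[OF A] by blast
      then obtain h where h: "h \<in> ?S" "f = [:p:] * h" by (auto simp: dvd_in_def)
      have "p * lead_coeff h = p * (u * prod_list (remove1 p ps))"
      proof -
        have "lead_coeff f = p * lead_coeff h" using h(2) by (simp add: lead_coeff_mult)
        moreover have "prod_list ps = p * prod_list (remove1 p ps)"
          using p(1) by (induction ps) (auto simp: ac_simps)
        ultimately show ?thesis using less.prems(1)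
          by (simp add: prime_factorization_in_def ac_simps)
      qed
      hence "lead_coeff h = u * prod_list (remove1 p ps)" using prime_inD(2)[OF pp] by simp
      hence "prime_factorization_in A (lead_coeff h) u (remove1 p ps)"
        using less.prems(1) notin_set_remove1 by (fastforce simp: prime_factorization_in_def)
      moreover have "length (remove1 p ps) < length ps"
        using p(1) by (simp add: length_remove1) (metis Suc_pred length_pos_if_in_set lessI)
      moreover have "h \<noteq> 0" using less.prems(3) h(2) by auto
      ultimately obtain c g where cg: "c \<in> A" "c \<noteq> 0" "g \<in> ?S" "primitive_over A g" "h = [:c:] * g"
        using less.hyps[of "remove1 p ps" h] h(1) by blast
      show ?thesis
        using cg h(2) pp subring_set_mult[OF A] prime_inD(1,2)[OF pp]
        by (intro exI[of _ "p * c"] exI[of _ g]) (auto simp: mult.commute)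
    qed
  qed
  thus ?thesis using that by blast
qed

text \<open>
  Division with remainder by \<open>h\<close> over a domain, at the price of a nonzero constant \<open>a\<close>: each
  elimination of a leading term multiplies the dividend by the leading coefficient of \<open>h\<close>.
\<close>

lemma pseudo_division_over:
  fixes A :: "'a::idom set"
  assumes A: "subring_set A" and f: "f \<in> polys_over A" and h: "h \<in> polys_over A" "h \<noteq> 0"
  obtains a q r where "a \<in> A" "a \<noteq> 0" "q \<in> polys_over A" "r \<in> polys_over A"
    "[:a:] * f = q * h + r" "r = 0 \<or> degree r < degree h"
proof -
  let ?S = "polys_over A"
  note S = subring_polys_over[OF A]
  have "\<forall>i\<ge>n. coeff f i = 0 \<Longrightarrow> f \<in> ?S \<Longrightarrow> \<exists>a q r. a \<in> A \<and> a \<noteq> 0 \<and> q \<in> ?S \<and> r \<in> ?S \<and>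
      [:a:] * f = q * h + r \<and> (\<forall>i\<ge>degree h. coeff r i = 0)" for n f
  proof (induction n arbitrary: f)
    case 0
    thus ?case using subring_set_one[OF A] subring_set_zero[OF S]
      by (intro exI[of _ 1] exI[of _ 0] exI[of _ f]) auto
  next
    case (Suc n)
    show ?case
    proof (cases "n < degree h")
      case True
      thus ?thesis using Suc.prems subring_set_one[OF A] subring_set_zero[OF S]
        by (intro exI[of _ 1] exI[of _ 0] exI[of _ f]) auto
    next
      case False
      define m where "m = monom (coeff f n) (n - degree h)"
      define f' where "f' = [:lead_coeff h:] * f - m * h"
      have m: "m \<in> ?S" unfolding m_def by (intro monom_in_polys_over A polys_overD Suc.prems)
      have l: "lead_coeff h \<in> A" by (intro polys_overD h)
      have "f' \<in> ?S" unfolding f'_def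
        by (intro subring_set_diff[OF S] subring_set_mult[OF S] const_in_polys_over A l m h Suc.prems)
      moreover have "\<forall>i\<ge>n. coeff f' i = 0"
      proof (intro allI impI)
        fix i assume "n \<le> i"
        show "coeff f' i = 0"
        proof (cases "i = n")
          case True
          thus ?thesis using False by (simp add: f'_def m_def coeff_monom_mult)
        next
          case f: False
          hence "coeff f i = 0" "coeff h (i - (n - degree h)) = 0"
            using Suc.prems(1) \<open>n \<le> i\<close> False by (auto intro: coeff_eq_0)
          thus ?thesis by (simp add: f'_def m_def coeff_monom_mult)
        qed
      qed
      ultimately obtain a q r where *: "a \<in> A" "a \<noteq> 0" "q \<in> ?S" "r \<in> ?S"
          "[:a:] * f' = q * h + r" "\<forall>i\<ge>degree h. coeff r i = 0"
        using Suc.IH by blast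
      have "[:a * lead_coeff h:] * f = [:a:] * f' + [:a:] * m * h"
        by (simp add: f'_def algebra_simps smult_diff_right)
      also have "\<dots> = (q + [:a:] * m) * h + r" using *(5) by (simp add: algebra_simps)
      finally show ?thesis
        using * h(2) subring_set_mult[OF A *(1) l]
          subring_set_add[OF S *(3) subring_set_mult[OF S const_in_polys_over[OF A *(1)] m]]
        by (intro exI[of _ "a * lead_coeff h"] exI[of _ "q + [:a:] * m"] exI[of _ r]) auto
    qed
  qed
  from this[of "Suc (degree f)" f] f
  obtain a q r where *: "a \<in> A" "a \<noteq> 0" "q \<in> ?S" "r \<in> ?S"
      "[:a:] * f = q * h + r" "\<forall>i\<ge>degree h. coeff r i = 0"
    by (auto simp: coeff_eq_0)
  have "r = 0 \<or> degree r < degree h" using *(6) by (metis leI leading_coeff_0_iff)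
  thus ?thesis using that * by blast
qed

text \<open>
  This is Gauss's lemma. Suppose \<open>g\<close> divides \<open>u * v\<close>, and let \<open>h\<close> be a nonzero element of least degree
  in the ideal generated by \<open>g\<close> and \<open>u\<close>. By pseudo-division the primitive part \<open>h'\<close> of \<open>h\<close> divides
  every element of that ideal, in particular \<open>g\<close>. As \<open>g\<close> has no proper decomposition, either \<open>h'\<close> is
  constant, whence a nonzero constant is a combination of \<open>g\<close> and \<open>u\<close> and \<open>g\<close> divides \<open>v\<close>, or \<open>h'\<close>
  is associated to \<open>g\<close> and \<open>g\<close> divides \<open>u\<close>. Working with this ideal replaces the passage to the
  quotient field of \<open>A\<close>.
\<close>

lemma indecomposable_primitive_is_prime:
  fixes A :: "'a::idom set"
  assumes ufd: "ufd_set A" and g: "g \<in> polys_over A" "primitive_over A g" "degree g > 0"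
    and indec: "\<And>g1 g2. g1 \<in> polys_over A \<Longrightarrow> g2 \<in> polys_over A \<Longrightarrow> g = g1 * g2 \<Longrightarrow>
      degree g1 = 0 \<or> degree g2 = 0"
  shows "prime_in (polys_over A) g"
  unfolding prime_in_def
proof (intro conjI ballI impI)
  let ?S = "polys_over A"
  have A: "subring_set A" using ufd by (simp add: ufd_set_def)
  note S = subring_polys_over[OF A]
  show "g \<in> ?S" by fact
  show "g \<noteq> 0" using g(3) by auto
  show "\<not> dvd_in ?S g 1"
  proof
    assume "dvd_in ?S g 1"
    then obtain h where "1 = g * h" by (auto simp: dvd_in_def)
    hence "degree g = 0" using degree_mult_eq[of g h]
      by (metis add_is_0 degree_1 mult_zero_left mult_zero_right zero_neq_one)
    thus False using g(3) by simp
  qed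
  fix u v assume u: "u \<in> ?S" and v: "v \<in> ?S" and uv: "dvd_in ?S g (u * v)"
  define J where "J = {s * g + t * u | s t. s \<in> ?S \<and> t \<in> ?S}"
  have JS: "J \<subseteq> ?S" unfolding J_def
    using subring_set_add[OF S] subring_set_mult[OF S] g(1) u by blast
  have gJ: "g \<in> J" unfolding J_def
    using subring_set_one[OF S] subring_set_zero[OF S] by (force intro: exI[of _ 1] exI[of _ 0])
  have uJ: "u \<in> J" unfolding J_def
    using subring_set_one[OF S] subring_set_zero[OF S] by (force intro: exI[of _ 1] exI[of _ 0])
  have Jlin: "a * w - q * h \<in> J" if a: "a \<in> ?S" and q: "q \<in> ?S" and w: "w \<in> J" and h: "h \<in> J" for a w q h
  proof -
    obtain s t s' t' where st: "w = s * g + t * u" "h = s' * g + t' * u" "s \<in> ?S" "t \<in> ?S" "s' \<in> ?S" "t' \<in> ?S"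
      using w h unfolding J_def by blast
    have "a * w - q * h = (a * s - q * s') * g + (a * t - q * t') * u"
      by (simp add: st algebra_simps)
    moreover have "a * s - q * s' \<in> ?S" "a * t - q * t' \<in> ?S"
      using a q st by (auto intro!: subring_set_diff[OF S] subring_set_mult[OF S])
    ultimately show ?thesis unfolding J_def by blast
  qed
  obtain h where h: "h \<in> J" "h \<noteq> 0" "\<And>w. w \<in> J \<Longrightarrow> w \<noteq> 0 \<Longrightarrow> degree h \<le> degree w"
    using ex_has_least_nat[of "\<lambda>h. h \<in> J \<and> h \<noteq> 0" g degree] gJ g(3) by force
  have hS: "h \<in> ?S" using h JS by blast
  obtain c h' where ch: "c \<in> A" "c \<noteq> 0" "h' \<in> ?S" "primitive_over A h'" "h = [:c:] * h'"
    using primitive_part_exists[OF ufd hS h(2)] by blast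
  have J_dvd: "dvd_in ?S h' w" if w: "w \<in> J" for w
  proof -
    have wS: "w \<in> ?S" using w JS by blast
    obtain a q r where *: "a \<in> A" "a \<noteq> 0" "q \<in> ?S" "r \<in> ?S"
        "[:a:] * w = q * h + r" "r = 0 \<or> degree r < degree h"
      using pseudo_division_over[OF A wS hS h(2)] by blast
    have "r = [:a:] * w - q * h" using *(5) by simp
    hence "r \<in> J" using Jlin[OF const_in_polys_over[OF A *(1)] *(3) w h(1)] by simp
    hence "r = 0" using h(3)[of r] *(6) by (meson not_le)
    hence "[:a:] * w = h' * (q * [:c:])" using *(5) ch(5) by (simp add: ac_simps)
    moreover have "q * [:c:] \<in> ?S" by (intro subring_set_mult[OF S] *(3) const_in_polys_over A ch)
    ultimately have "dvd_in ?S h' ([:a:] * w)" unfolding dvd_in_def by blast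
    thus ?thesis using primitive_cancel_const[OF ufd ch(3,4) wS *(1,2)] by blast
  qed
  obtain q where q: "q \<in> ?S" "g = h' * q" using J_dvd[OF gJ] by (auto simp: dvd_in_def)
  from indec[OF ch(3) q] show "dvd_in ?S g u \<or> dvd_in ?S g v"
  proof
    assume "degree h' = 0"
    hence "degree h = 0" using ch(5) by simp
    then obtain b where b: "h = [:b:]" by (metis degree_eq_zeroE)
    hence bA: "b \<in> A" "b \<noteq> 0" using polys_overD[OF hS, of 0] h(2) by auto
    obtain s t where st: "h = s * g + t * u" "s \<in> ?S" "t \<in> ?S" using h(1) unfolding J_def by blast
    have "dvd_in ?S g (g * (s * v) + (u * v) * t)"
      by (intro dvd_in_add[OF S] dvd_in_mult[OF S uv] dvd_in_triv[OF S] subring_set_mult[OF S] st v)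
    moreover have "g * (s * v) + (u * v) * t = [:b:] * v"
      unfolding b[symmetric] st(1) by (simp add: algebra_simps)
    ultimately have "dvd_in ?S g ([:b:] * v)" by simp
    thus ?thesis using primitive_cancel_const[OF ufd g(1,2) v bA] by blast
  next
    assume "degree q = 0"
    then obtain b where b: "q = [:b:]" by (metis degree_eq_zeroE)
    have bA: "b \<in> A" "b \<noteq> 0" using polys_overD[OF q(1), of 0] b q(2) g(3) by auto
    obtain x ps where fact: "prime_factorization_in A b x ps" using ufd bA by (auto simp: ufd_set_def)
    have "ps = []"
    proof (rule ccontr)
      assume "ps \<noteq> []"
      then obtain p ps' where Cons: "ps = p # ps'" by (cases ps) auto
      hence p: "prime_in A p" and ps': "\<forall>p\<in>set ps'. prime_in A p" and x: "x \<in> A" and beq: "b = p * (x * prod_list ps')"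
        using fact by (auto simp: prime_factorization_in_def ac_simps)
      have "g = [:p:] * (h' * [:x * prod_list ps':])" using q(2) b beq by (simp add: ac_simps)
      moreover have "h' * [:x * prod_list ps':] \<in> ?S"
        by (intro subring_set_mult[OF S] ch const_in_polys_over A subring_set_mult[OF A] x prod_list_in_primes[OF A ps'])
      ultimately have "dvd_in ?S [:p:] g" unfolding dvd_in_def by blast
      thus False using g(2) p by (auto simp: primitive_over_def)
    qed
    hence "dvd_in A b 1" using fact by (auto simp: prime_factorization_in_def)
    then obtain y where y: "y \<in> A" "1 = b * y" by (auto simp: dvd_in_def)
    have "h' = g * [:y:]" using q(2) b y(2) by (simp add: ac_simps)
    hence "dvd_in ?S g h'" using const_in_polys_over[OF A y(1)] unfolding dvd_in_def by blast
    thus ?thesis using J_dvd[OF uJ] dvd_in_trans[OF S] by blast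
  qed
qed

text \<open>
  Induction on the degree: split off the content, then decompose the primitive part into factors of
  smaller degree for as long as possible.
\<close>

theorem gauss_ufd_polys_over:
  fixes A :: "'a::idom set"
  assumes ufd: "ufd_set A"
  shows "ufd_set (polys_over A)"
  unfolding ufd_set_def
proof (intro conjI ballI impI)
  let ?S = "polys_over A"
  have A: "subring_set A" using ufd by (simp add: ufd_set_def)
  note S = subring_polys_over[OF A]
  show "subring_set ?S" by fact
  have const: "\<exists>u ps. prime_factorization_in ?S [:c:] u ps" if c: "c \<in> A" "c \<noteq> 0" for c
  proof -
    obtain u ps where "prime_factorization_in A c u ps" using ufd c by (auto simp: ufd_set_def)
    hence u: "u \<in> A" "dvd_in A u 1" and ps: "\<forall>p\<in>set ps. prime_in A p" and ceq: "c = u * prod_list ps"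
      by (auto simp: prime_factorization_in_def)
    have "dvd_in ?S [:u:] 1"
    proof -
      obtain v where v: "v \<in> A" "1 = u * v" using u(2) by (auto simp: dvd_in_def)
      have "1 = [:u:] * [:v:]" using v(2) by (simp add: one_pCons mult.commute)
      thus ?thesis using const_in_polys_over[OF A v(1)] unfolding dvd_in_def by blast
    qed
    moreover have "\<forall>p\<in>set (map (\<lambda>p. [:p:]) ps). prime_in ?S p"
      using ps prime_in_polys_over_const[OF A] by auto
    moreover have "prod_list (map (\<lambda>p. [:p:]) ps) = [:prod_list ps:]"
      by (induction ps) (auto simp: one_pCons)
    ultimately have "prime_factorization_in ?S [:c:] [:u:] (map (\<lambda>p. [:p:]) ps)"
      using const_in_polys_over[OF A u(1)] ceq by (auto simp: prime_factorization_in_def)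
    thus ?thesis by blast
  qed
  fix f assume "f \<in> ?S" "f \<noteq> 0"
  thus "\<exists>u ps. prime_factorization_in ?S f u ps"
  proof (induction "degree f" arbitrary: f rule: less_induct)
    case less
    obtain c g where cg: "c \<in> A" "c \<noteq> 0" "g \<in> ?S" "primitive_over A g" "f = [:c:] * g"
      using primitive_part_exists[OF ufd less.prems] by blast
    have g0: "g \<noteq> 0" and dg: "degree g = degree f" using cg less.prems by auto
    have "\<exists>u ps. prime_factorization_in ?S g u ps"
    proof (cases "degree g = 0")
      case True
      then obtain b where "g = [:b:]" by (metis degree_eq_zeroE)
      thus ?thesis using const[of b] polys_overD[OF cg(3), of 0] g0 by auto
    next
      case False
      show ?thesis
      proof (cases "\<exists>g1\<in>?S. \<exists>g2\<in>?S. g = g1 * g2 \<and> degree g1 \<noteq> 0 \<and> degree g2 \<noteq> 0")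
        case True
        then obtain g1 g2 where g12: "g1 \<in> ?S" "g2 \<in> ?S" "g = g1 * g2" "degree g1 \<noteq> 0" "degree g2 \<noteq> 0"
          by blast
        hence "g1 \<noteq> 0" "g2 \<noteq> 0" by auto
        moreover from this have "degree g1 < degree f" "degree g2 < degree f"
          using g12 dg by (auto simp: degree_mult_eq)
        ultimately obtain u ps v qs where "prime_factorization_in ?S g1 u ps" "prime_factorization_in ?S g2 v qs"
          using less.hyps g12 by meson
        thus ?thesis using prime_factorization_in_mult[OF S] g12(3) by blast
      next
        case indec: False
        have "prime_in ?S g"
          using indec False by (intro indecomposable_primitive_is_prime[OF ufd cg(3,4)]) auto
        hence "prime_factorization_in ?S g 1 [g]"
          using subring_set_one[OF S] dvd_in_refl[OF S] by (auto simp: prime_factorization_in_def)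
        thus ?thesis by blast
      qed
    qed
    thus ?case using prime_factorization_in_mult[OF S] const[OF cg(1,2)] cg(5) by blast
  qed
qed

section \<open>Iterated polynomial rings inside a field\<close>

text \<open>
  The polynomial rings that occur all live inside one field, as \<open>adjoin A x\<close> with \<open>x\<close> transcendental
  over the subring \<open>A\<close>. This keeps the number of indeterminates a variable, and lets statements
  about several indeterminates be proved by adjoining one at a time.
\<close>

definition adjoin :: "'a::comm_ring_1 set \<Rightarrow> 'a \<Rightarrow> 'a set" where
  "adjoin A x = (\<lambda>p. poly p x) ` polys_over A"

definition transcendental_over :: "'a::comm_ring_1 set \<Rightarrow> 'a \<Rightarrow> bool" where
  "transcendental_over A x \<longleftrightarrow> (\<forall>p\<in>polys_over A. poly p x = 0 \<longrightarrow> p = 0)"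

lemma subring_adjoin:
  assumes A: "subring_set A"
  shows "subring_set (adjoin A x)"
  unfolding subring_set_def
proof (intro conjI ballI)
  note S = subring_polys_over[OF A]
  have "poly 1 x \<in> adjoin A x" using subring_set_one[OF S] unfolding adjoin_def by blast
  thus "1 \<in> adjoin A x" by simp
  fix a b assume "a \<in> adjoin A x" "b \<in> adjoin A x"
  then obtain p q where "p \<in> polys_over A" "q \<in> polys_over A" "a = poly p x" "b = poly q x"
    by (auto simp: adjoin_def)
  thus "a - b \<in> adjoin A x" "a * b \<in> adjoin A x"
    using subring_set_diff[OF S, of p q] subring_set_mult[OF S, of p q] unfolding adjoin_def
    by (metis image_eqI poly_diff, metis image_eqI poly_mult)
qed

lemma subset_adjoin:
  assumes A: "subring_set A"
  shows "A \<subseteq> adjoin A x"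
proof
  fix a assume "a \<in> A"
  hence "poly [:a:] x \<in> adjoin A x" unfolding adjoin_def using const_in_polys_over[OF A] by blast
  thus "a \<in> adjoin A x" by simp
qed

lemma var_in_polys_over: "subring_set A \<Longrightarrow> [:0, 1:] \<in> polys_over A"
  by (auto simp: polys_over_def coeff_pCons subring_set_zero subring_set_one split: nat.splits)

lemma in_adjoin:
  assumes A: "subring_set A"
  shows "x \<in> adjoin A x"
proof -
  have "poly [:0, 1:] x \<in> adjoin A x" unfolding adjoin_def using var_in_polys_over[OF A] by blast
  thus ?thesis by simp
qed

lemma poly_in_subring:
  assumes B: "subring_set B" and "\<And>i. coeff p i \<in> B" "x \<in> B"
  shows "poly p x \<in> B"
  unfolding poly_altdef
  by (intro subring_set_sum[OF B] subring_set_mult[OF B] subring_set_power[OF B] assms)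

lemma adjoin_induct [consumes 2, case_names base gen add mult]:
  assumes A: "subring_set A" and a: "a \<in> adjoin A x"
    and base: "\<And>c. c \<in> A \<Longrightarrow> P c" and gen: "P x"
    and add: "\<And>a b. a \<in> adjoin A x \<Longrightarrow> b \<in> adjoin A x \<Longrightarrow> P a \<Longrightarrow> P b \<Longrightarrow> P (a + b)"
    and mult: "\<And>a b. a \<in> adjoin A x \<Longrightarrow> b \<in> adjoin A x \<Longrightarrow> P a \<Longrightarrow> P b \<Longrightarrow> P (a * b)"
  shows "P a"
proof -
  let ?B = "{a \<in> adjoin A x. P a}"
  have A': "A \<subseteq> ?B" using subset_adjoin[OF A] base by blast
  have x: "x \<in> ?B" using in_adjoin[OF A] gen by blast
  have add': "a + b \<in> ?B" and mult': "a * b \<in> ?B" if "a \<in> ?B" "b \<in> ?B" for a b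
    using that add[of a b] mult[of a b] subring_set_add[OF subring_adjoin[OF A], of a x b]
      subring_set_mult[OF subring_adjoin[OF A], of a x b] by auto
  have "subring_set ?B"
    unfolding subring_set_def
  proof (intro conjI ballI)
    show "1 \<in> ?B" using A' subring_set_one[OF A] by blast
    fix a b assume ab: "a \<in> ?B" "b \<in> ?B"
    show "a * b \<in> ?B" using mult'[OF ab] .
    have "- 1 \<in> ?B" using A' subring_set_uminus[OF A subring_set_one[OF A]] by blast
    from add'[OF ab(1) mult'[OF this ab(2)]] show "a - b \<in> ?B" by simp
  qed
  moreover obtain p where "p \<in> polys_over A" "a = poly p x" using a by (auto simp: adjoin_def)
  ultimately have "a \<in> ?B" using poly_in_subring[of ?B p x] polys_overD A' x by blast
  thus ?thesis by blast
qed

lemma transcendental_inj: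
  assumes A: "subring_set A" and x: "transcendental_over A x"
    and "p \<in> polys_over A" "q \<in> polys_over A" "poly p x = poly q x"
  shows "p = q"
proof -
  have "poly (p - q) x = 0" using assms(5) by simp
  thus ?thesis
    using x subring_set_diff[OF subring_polys_over[OF A] assms(3,4)] by (auto simp: transcendental_over_def)
qed

text \<open>
  Evaluation at a transcendental \<open>x\<close> is an isomorphism from \<open>polys_over A\<close> onto \<open>adjoin A x\<close>; it carries
  primes and prime factorizations over.
\<close>

lemma ufd_adjoin:
  fixes A :: "'a::idom set"
  assumes ufd: "ufd_set A" and x: "transcendental_over A x"
  shows "ufd_set (adjoin A x)"
  unfolding ufd_set_def
proof (intro conjI ballI impI)
  let ?S = "polys_over A"
  have A: "subring_set A" using ufd by (simp add: ufd_set_def)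
  note S = subring_polys_over[OF A]
  have adj: "adjoin A x = (\<lambda>p. poly p x) ` ?S" by (simp add: adjoin_def)
  note inj = transcendental_inj[OF A x]
  have dvd: "dvd_in (adjoin A x) (poly p x) (poly q x) \<longleftrightarrow> dvd_in ?S p q"
    if pq: "p \<in> ?S" "q \<in> ?S" for p q
  proof
    assume "dvd_in (adjoin A x) (poly p x) (poly q x)"
    then obtain r where r: "r \<in> ?S" "poly q x = poly p x * poly r x"
      unfolding dvd_in_def adj by auto
    hence "q = p * r" using pq subring_set_mult[OF S] by (intro inj) auto
    thus "dvd_in ?S p q" using r unfolding dvd_in_def by blast
  next
    assume "dvd_in ?S p q"
    thus "dvd_in (adjoin A x) (poly p x) (poly q x)" unfolding dvd_in_def adj by auto
  qed
  have one: "1 \<in> ?S" using subring_set_one[OF S] .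
  have prime: "prime_in (adjoin A x) (poly p x)" if p: "prime_in ?S p" for p
    unfolding prime_in_def
  proof (intro conjI ballI impI)
    show "poly p x \<in> adjoin A x" using prime_inD(1)[OF p] by (auto simp: adj)
    show "poly p x \<noteq> 0" using x prime_inD(1,2)[OF p] by (auto simp: transcendental_over_def)
    show "\<not> dvd_in (adjoin A x) (poly p x) 1"
      using dvd[OF prime_inD(1)[OF p] one] prime_inD(3)[OF p] by simp
    fix a b assume "a \<in> adjoin A x" "b \<in> adjoin A x" and ab: "dvd_in (adjoin A x) (poly p x) (a * b)"
    then obtain q r where qr: "q \<in> ?S" "r \<in> ?S" "a = poly q x" "b = poly r x" by (auto simp: adj)
    have "dvd_in ?S p (q * r)"
      using ab dvd[OF prime_inD(1)[OF p] subring_set_mult[OF S qr(1,2)]] qr by simp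
    thus "dvd_in (adjoin A x) (poly p x) a \<or> dvd_in (adjoin A x) (poly p x) b"
      using dvd[OF prime_inD(1)[OF p]] prime_inD(4)[OF p] qr by simp
  qed
  show "subring_set (adjoin A x)" by (rule subring_adjoin[OF A])
  fix a assume "a \<in> adjoin A x" "a \<noteq> 0"
  then obtain p where p: "p \<in> ?S" "a = poly p x" by (auto simp: adj)
  have "p \<noteq> 0" using p(2) \<open>a \<noteq> 0\<close> by auto
  obtain u ps where "prime_factorization_in ?S p u ps"
    using gauss_ufd_polys_over[OF ufd] p(1) \<open>p \<noteq> 0\<close> by (auto simp: ufd_set_def)
  hence u: "u \<in> ?S" "dvd_in ?S u 1" and ps: "\<forall>p\<in>set ps. prime_in ?S p" and peq: "p = u * prod_list ps"
    by (auto simp: prime_factorization_in_def)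
  have "poly (prod_list ps) x = prod_list (map (\<lambda>p. poly p x) ps)" by (induction ps) auto
  hence "prime_factorization_in (adjoin A x) a (poly u x) (map (\<lambda>p. poly p x) ps)"
    using u ps peq p dvd[OF u(1) one] prime by (auto simp: prime_factorization_in_def adj)
  thus "\<exists>u ps. prime_factorization_in (adjoin A x) a u ps" by blast
qed

definition hom_on :: "'a::comm_ring_1 set \<Rightarrow> ('a \<Rightarrow> 'b::comm_ring_1) \<Rightarrow> bool" where
  "hom_on A h \<longleftrightarrow> (\<forall>a\<in>A. \<forall>b\<in>A. h (a + b) = h a + h b \<and> h (a * b) = h a * h b)"

lemma hom_on_zero:
  assumes A: "subring_set A" and h: "hom_on A h"
  shows "h 0 = 0"
proof -
  have "h (0 + 0) = h 0 + h 0" using h subring_set_zero[OF A] unfolding hom_on_def by blast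
  thus ?thesis by simp
qed

lemma hom_on_sum:
  assumes A: "subring_set A" and h: "hom_on A h" and f: "\<And>i. i \<in> I \<Longrightarrow> f i \<in> A"
  shows "h (sum f I) = (\<Sum>i\<in>I. h (f i))"
  using f
proof (induction I rule: infinite_finite_induct)
  case (insert i I)
  thus ?case using h subring_set_sum[OF A, of I f] by (auto simp: hom_on_def)
qed (auto simp: hom_on_zero[OF A h])

text \<open>
  The universal property of a polynomial ring in one indeterminate. Elements of \<open>adjoin A x\<close> are
  identified with polynomials through the injectivity of evaluation at \<open>x\<close>.
\<close>

lemma extend_hom_on:
  fixes h :: "'a::comm_ring_1 \<Rightarrow> 'b::comm_ring_1"
  assumes A: "subring_set A" and x: "transcendental_over A x" and h: "hom_on A h" "h 1 = 1"
  obtains h' where "hom_on (adjoin A x) h'" "\<And>a. a \<in> A \<Longrightarrow> h' a = h a" "h' x = z"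
proof -
  let ?S = "polys_over A"
  note S = subring_polys_over[OF A]
  note h0 = hom_on_zero[OF A h(1)]
  define h' where "h' e = poly (map_poly h (SOME p. p \<in> ?S \<and> poly p x = e)) z" for e
  have h': "h' (poly p x) = poly (map_poly h p) z" if p: "p \<in> ?S" for p
  proof -
    have "(SOME q. q \<in> ?S \<and> poly q x = poly p x) = p"
      using p transcendental_inj[OF A x] by (intro some_equality) auto
    thus ?thesis by (simp add: h'_def)
  qed
  have "hom_on (adjoin A x) h'"
    unfolding hom_on_def
  proof (intro ballI)
    fix a b assume "a \<in> adjoin A x" "b \<in> adjoin A x"
    then obtain p q where pq: "p \<in> ?S" "q \<in> ?S" "a = poly p x" "b = poly q x"
      by (auto simp: adjoin_def)
    have "map_poly h (p + q) = map_poly h p + map_poly h q"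
      using h(1) pq by (intro poly_eqI) (simp add: coeff_map_poly h0 hom_on_def polys_overD)
    moreover have "map_poly h (p * q) = map_poly h p * map_poly h q"
    proof (rule poly_eqI)
      fix n
      have "h (\<Sum>i\<le>n. coeff p i * coeff q (n - i)) = (\<Sum>i\<le>n. h (coeff p i * coeff q (n - i)))"
        by (intro hom_on_sum[OF A h(1)] subring_set_mult[OF A] polys_overD pq)
      also have "\<dots> = (\<Sum>i\<le>n. h (coeff p i) * h (coeff q (n - i)))"
        using h(1) pq by (intro sum.cong refl) (simp add: hom_on_def polys_overD)
      finally show "coeff (map_poly h (p * q)) n = coeff (map_poly h p * map_poly h q) n"
        by (simp add: coeff_map_poly h0 coeff_mult)
    qed
    ultimately show "h' (a + b) = h' a + h' b \<and> h' (a * b) = h' a * h' b"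
      using h'[OF pq(1)] h'[OF pq(2)] h'[OF subring_set_add[OF S pq(1,2)]]
        h'[OF subring_set_mult[OF S pq(1,2)]] pq(3,4) by simp
  qed
  moreover have "h' a = h a" if "a \<in> A" for a
    using h'[OF const_in_polys_over[OF A that]] by (simp add: map_poly_pCons h0)
  moreover have "h' x = z"
    using h'[OF var_in_polys_over[OF A]] by (simp add: map_poly_pCons h0 h(2))
  ultimately show ?thesis using that by blast
qed

fun poly_tower :: "'a::comm_ring_1 set \<Rightarrow> 'a list \<Rightarrow> 'a set" where
  "poly_tower C [] = C"
| "poly_tower C (y # ys) = adjoin (poly_tower C ys) y"

fun indep_tower :: "'a::comm_ring_1 set \<Rightarrow> 'a list \<Rightarrow> bool" where
  "indep_tower C [] \<longleftrightarrow> True"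
| "indep_tower C (y # ys) \<longleftrightarrow> indep_tower C ys \<and> transcendental_over (poly_tower C ys) y"

lemma poly_tower_append: "poly_tower C (xs @ ys) = poly_tower (poly_tower C ys) xs"
  by (induction xs) auto

lemma indep_tower_append:
  "indep_tower C (xs @ ys) \<longleftrightarrow> indep_tower C ys \<and> indep_tower (poly_tower C ys) xs"
  by (induction xs) (auto simp: poly_tower_append)

lemma subring_poly_tower: "subring_set C \<Longrightarrow> subring_set (poly_tower C ys)"
  by (induction ys) (auto intro: subring_adjoin)

lemma base_subset_poly_tower: "subring_set C \<Longrightarrow> C \<subseteq> poly_tower C ys"
proof (induction ys)
  case (Cons y ys)
  thus ?case using subset_adjoin[OF subring_poly_tower, of C ys y] by auto
qed auto

lemma gens_subset_poly_tower: "subring_set C \<Longrightarrow> set ys \<subseteq> poly_tower C ys"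
proof (induction ys)
  case (Cons y ys)
  thus ?case
    using subset_adjoin[OF subring_poly_tower, of C ys y] in_adjoin[OF subring_poly_tower, of C y ys]
    by auto
qed auto

text \<open>
  Every identity between additive maps that are multiplicative, or satisfy the Leibniz rule, is proved
  below by this rule: it suffices to check it on the coefficients and on the indeterminates.
\<close>

lemma poly_tower_induct [consumes 2, case_names base gen add mult]:
  assumes C: "subring_set C" and a: "a \<in> poly_tower C ys"
    and base: "\<And>c. c \<in> C \<Longrightarrow> P c" and gen: "\<And>y. y \<in> set ys \<Longrightarrow> P y"
    and add: "\<And>a b. a \<in> poly_tower C ys \<Longrightarrow> b \<in> poly_tower C ys \<Longrightarrow> P a \<Longrightarrow> P b \<Longrightarrow> P (a + b)"
    and mult: "\<And>a b. a \<in> poly_tower C ys \<Longrightarrow> b \<in> poly_tower C ys \<Longrightarrow> P a \<Longrightarrow> P b \<Longrightarrow> P (a * b)"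
  shows "P a"
  using a gen add mult
proof (induction ys arbitrary: a)
  case Nil
  thus ?case using base by simp
next
  case (Cons y ys)
  note A = subring_poly_tower[OF C, of ys]
  have sub: "a \<in> poly_tower C (y # ys)" if "a \<in> poly_tower C ys" for a
    using subset_adjoin[OF A] that by auto
  from A Cons.prems(1)[unfolded poly_tower.simps] show ?case
  proof (induction rule: adjoin_induct)
    case (base c)
    show ?case
    proof (rule Cons.IH[OF base])
      show "P z" if "z \<in> set ys" for z using Cons.prems(2) that by simp
      show "P (a + b)" "P (a * b)" if "a \<in> poly_tower C ys" "b \<in> poly_tower C ys" "P a" "P b" for a b
        using Cons.prems(3,4) sub that by blast+
    qed
  qed (use Cons.prems in auto)
qed

lemma ufd_poly_tower:
  fixes C :: "'a::field set"
  assumes C: "subring_set C" and inv: "\<And>c. c \<in> C \<Longrightarrow> inverse c \<in> C" and "indep_tower C ys"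
  shows "ufd_set (poly_tower C ys)"
  using assms(3)
proof (induction ys)
  case Nil
  have "\<exists>u ps. prime_factorization_in C a u ps" if "a \<in> C" "a \<noteq> 0" for a
    using that inv[OF that(1)]
    by (intro exI[of _ a] exI[of _ "[]"])
       (auto simp: prime_factorization_in_def dvd_in_def intro!: bexI[of _ "inverse a"])
  thus ?case using C by (simp add: ufd_set_def)
qed (auto intro: ufd_adjoin)

lemma extend_hom_on_poly_tower:
  fixes h :: "'a::comm_ring_1 \<Rightarrow> 'b::comm_ring_1"
  assumes C: "subring_set C" and h: "hom_on C h" "h 1 = 1" and "indep_tower C ys"
  shows "\<exists>h'. hom_on (poly_tower C ys) h' \<and> (\<forall>c\<in>C. h' c = h c) \<and> (\<forall>y\<in>set ys. h' y = z y)"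
  using assms(4)
proof (induction ys)
  case Nil
  thus ?case using h by auto
next
  case (Cons y ys)
  note A = subring_poly_tower[OF C, of ys]
  have y: "transcendental_over (poly_tower C ys) y" using Cons.prems by simp
  obtain h1 where h1: "hom_on (poly_tower C ys) h1" "\<forall>c\<in>C. h1 c = h c" "\<forall>y\<in>set ys. h1 y = z y"
    using Cons by auto
  moreover have "h1 1 = 1" using h1(2) h(2) subring_set_one[OF C] by auto
  ultimately obtain h2 where h2: "hom_on (poly_tower C (y # ys)) h2"
      "\<And>a. a \<in> poly_tower C ys \<Longrightarrow> h2 a = h1 a" "h2 y = z y"
    using extend_hom_on[OF A y, of h1 "z y"] by auto
  have "\<forall>c\<in>C. h2 c = h c" using h2(2) h1(2) base_subset_poly_tower[OF C, of ys] by auto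
  moreover have "\<forall>y'\<in>set (y # ys). h2 y' = z y'"
    using h2 h1(3) gens_subset_poly_tower[OF C, of ys] by auto
  ultimately show ?case using h2(1) by blast
qed

section \<open>Linear differential systems and constants\<close>

lemma derivationD:
  assumes "derivation D"
  shows derivation_add: "D (a + b) = D a + D b"
    and derivation_mult: "D (a * b) = D a * b + a * D b"
    and derivation_zero: "D 0 = 0"
    and derivation_one: "D 1 = 0"
    and derivation_minus: "D (- a) = - D a"
    and derivation_diff: "D (a - b) = D a - D b"
proof -
  show add: "D (a + b) = D a + D b" and mult: "D (a * b) = D a * b + a * D b" for a b
    using assms by (auto simp: derivation_def)
  show zero: "D 0 = 0" using add[of 0 0] by simp
  show "D 1 = 0" using mult[of 1 1] by simp
  show minus: "D (- a) = - D a" for a using add[of a "- a"] zero by (simp add: eq_neg_iff_add_eq_0 add.commute)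
  show "D (a - b) = D a - D b" using add[of a "- b"] minus[of b] by simp
qed

lemma derivation_sum:
  assumes "derivation D"
  shows "D (sum f I) = (\<Sum>i\<in>I. D (f i))"
  by (induction I rule: infinite_finite_induct)
     (simp_all add: derivation_zero[OF assms] derivation_add[OF assms])

lemma derivation_divide:
  fixes D :: "'e::field \<Rightarrow> 'e"
  assumes "derivation D" "b \<noteq> 0"
  shows "D (a / b) = (D a - a / b * D b) / b"
proof -
  have "D a = D (a / b * b)" using assms(2) by simp
  also have "\<dots> = D (a / b) * b + a / b * D b" by (rule derivation_mult[OF assms(1)])
  finally show ?thesis using assms(2) by (simp add: field_simps)
qed

text \<open>
  Elimination of one equation \<open>i\<close>: solve it for the coefficient of some \<open>t\<close> with \<open>u t i \<noteq> 0\<close>.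
\<close>

lemma underdetermined_linear_system:
  fixes u :: "'s \<Rightarrow> 'i \<Rightarrow> 'e::field"
  assumes "finite I" "finite S" "card I < card S"
  shows "\<exists>c. (\<exists>s\<in>S. c s \<noteq> 0) \<and> (\<forall>i\<in>I. (\<Sum>s\<in>S. c s * u s i) = 0)"
  using assms
proof (induction I arbitrary: S u rule: finite_induct)
  case empty
  hence "S \<noteq> {}" by auto
  thus ?case by (intro exI[of _ "\<lambda>_. 1"]) auto
next
  case (insert i I)
  show ?case
  proof (cases "\<forall>s\<in>S. u s i = 0")
    case True
    obtain c where "\<exists>s\<in>S. c s \<noteq> 0" "\<forall>j\<in>I. (\<Sum>s\<in>S. c s * u s j) = 0"
      using insert.IH[OF insert.prems(1), of u] insert.prems(2) insert.hyps by auto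
    thus ?thesis using True by (intro exI[of _ c]) auto
  next
    case False
    then obtain t where t: "t \<in> S" "u t i \<noteq> 0" by blast
    let ?S = "S - {t}"
    have "card I < card ?S" using insert.prems insert.hyps t(1) by simp
    then obtain c where c: "\<exists>s\<in>?S. c s \<noteq> 0"
        "\<forall>j\<in>I. (\<Sum>s\<in>?S. c s * (u s j - u s i / u t i * u t j)) = 0"
      using insert.IH[of ?S "\<lambda>s j. u s j - u s i / u t i * u t j"] insert.prems by auto
    define d where "d = c(t := - (\<Sum>s\<in>?S. c s * u s i) / u t i)"
    have split: "(\<Sum>s\<in>S. d s * u s j) = - (\<Sum>s\<in>?S. c s * u s i) / u t i * u t j + (\<Sum>s\<in>?S. c s * u s j)" for j
    proof -
      have "(\<Sum>s\<in>S. d s * u s j) = d t * u t j + (\<Sum>s\<in>?S. d s * u s j)"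
        using insert.prems(1) t(1) by (rule sum.remove)
      also have "(\<Sum>s\<in>?S. d s * u s j) = (\<Sum>s\<in>?S. c s * u s j)"
        by (intro sum.cong) (auto simp: d_def)
      finally show ?thesis by (simp add: d_def)
    qed
    have "(\<Sum>s\<in>S. d s * u s j) = 0" if "j \<in> I" for j
    proof -
      have "0 = (\<Sum>s\<in>?S. c s * u s j - c s * u s i * (u t j / u t i))"
        using c(2) that by (simp add: algebra_simps)
      also have "\<dots> = (\<Sum>s\<in>?S. c s * u s j) - (\<Sum>s\<in>?S. c s * u s i) * (u t j / u t i)"
        unfolding sum_subtractf sum_distrib_right ..
      finally show ?thesis unfolding split by (simp add: algebra_simps)
    qed
    moreover have "(\<Sum>s\<in>S. d s * u s i) = 0" unfolding split using t(2) by simp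
    moreover have "\<exists>s\<in>S. d s \<noteq> 0" using c(1) by (auto simp: d_def)
    ultimately show ?thesis by (intro exI[of _ d]) auto
  qed
qed

text \<open>
  The Wronskian argument. A relation with minimal support, scaled so that one coefficient is \<open>1\<close>, is
  differentiated; since all the vectors solve the same linear system, the terms with \<open>D (u s i)\<close>
  cancel, and the derivatives of the coefficients form a relation with strictly smaller support. So
  these derivatives vanish and the coefficients are constants.
\<close>

lemma linear_differential_system_dependent:
  fixes D :: "'e::field \<Rightarrow> 'e" and u :: "'s \<Rightarrow> 'i \<Rightarrow> 'e"
  assumes D: "derivation D" and fin: "finite I" "finite S" and card: "card I < card S"
    and sys: "\<And>s i. s \<in> S \<Longrightarrow> i \<in> I \<Longrightarrow> D (u s i) = (\<Sum>j\<in>I. M i j * u s j)"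
  obtains c where "\<And>s. s \<in> S \<Longrightarrow> D (c s) = 0" "\<exists>s\<in>S. c s \<noteq> 0"
    "\<And>i. i \<in> I \<Longrightarrow> (\<Sum>s\<in>S. c s * u s i) = 0"
proof -
  define rel where "rel c \<longleftrightarrow> (\<forall>i\<in>I. (\<Sum>s\<in>S. c s * u s i) = 0)" for c
  define supp where "supp c = {s\<in>S. c s \<noteq> 0}" for c :: "'s \<Rightarrow> 'e"
  obtain c0 where "rel c0" "supp c0 \<noteq> {}"
    using underdetermined_linear_system[OF fin card, of u] by (auto simp: rel_def supp_def)
  then obtain c where c: "rel c" "supp c \<noteq> {}"
      and min: "\<And>c'. rel c' \<Longrightarrow> supp c' \<noteq> {} \<Longrightarrow> card (supp c) \<le> card (supp c')"
    using ex_has_least_nat[of "\<lambda>c. rel c \<and> supp c \<noteq> {}" c0 "\<lambda>c. card (supp c)"] by blast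
  obtain t where t: "t \<in> S" "c t \<noteq> 0" using c(2) by (auto simp: supp_def)
  define d where "d s = c s / c t" for s
  have d: "rel d"
  proof -
    have "(\<Sum>s\<in>S. d s * u s i) = (\<Sum>s\<in>S. c s * u s i) / c t" for i
      by (simp add: d_def sum_divide_distrib)
    thus ?thesis using c(1) by (simp add: rel_def)
  qed
  have "rel (\<lambda>s. D (d s))"
    unfolding rel_def
  proof
    fix i assume i: "i \<in> I"
    have "0 = D (\<Sum>s\<in>S. d s * u s i)" using d i by (simp add: rel_def derivation_zero[OF D])
    also have "\<dots> = (\<Sum>s\<in>S. D (d s) * u s i + d s * D (u s i))"
      by (simp add: derivation_sum[OF D] derivation_mult[OF D])
    also have "\<dots> = (\<Sum>s\<in>S. D (d s) * u s i) + (\<Sum>s\<in>S. d s * (\<Sum>j\<in>I. M i j * u s j))"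
      using sys i by (simp add: sum.distrib)
    also have "(\<Sum>s\<in>S. d s * (\<Sum>j\<in>I. M i j * u s j)) = (\<Sum>s\<in>S. \<Sum>j\<in>I. M i j * (d s * u s j))"
      by (simp add: sum_distrib_left ac_simps)
    also have "\<dots> = (\<Sum>j\<in>I. M i j * (\<Sum>s\<in>S. d s * u s j))"
      by (subst sum.swap) (simp add: sum_distrib_left)
    also have "\<dots> = 0" using d by (simp add: rel_def)
    finally show "(\<Sum>s\<in>S. D (d s) * u s i) = 0" by simp
  qed
  moreover have "card (supp (\<lambda>s. D (d s))) < card (supp c)"
  proof (rule psubset_card_mono)
    show "finite (supp c)" using fin by (simp add: supp_def)
    have "t \<notin> supp (\<lambda>s. D (d s))" using t by (simp add: supp_def d_def derivation_one[OF D])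
    moreover have "t \<in> supp c" using t by (simp add: supp_def)
    moreover have "supp (\<lambda>s. D (d s)) \<subseteq> supp c"
      by (auto simp: supp_def d_def derivation_zero[OF D])
    ultimately show "supp (\<lambda>s. D (d s)) \<subset> supp c" by blast
  qed
  ultimately have "supp (\<lambda>s. D (d s)) = {}" using min by (meson not_le)
  moreover have "\<exists>s\<in>S. d s \<noteq> 0" using t by (auto simp: d_def)
  ultimately show ?thesis using that[of d] d by (auto simp: rel_def supp_def)
qed

section \<open>Spans, degrees and partial derivatives\<close>

text \<open>
  For finite \<open>V\<close> this is the span of \<open>V\<close> over the subring \<open>C\<close> of scalars.
\<close>

definition lin_span :: "'a::comm_ring_1 set \<Rightarrow> 'a set \<Rightarrow> 'a set" where
  "lin_span C V = {\<Sum>v\<in>V. c v * v | c. \<forall>v\<in>V. c v \<in> C}"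

context
  fixes C :: "'a::comm_ring_1 set"
  assumes C: "subring_set C"
begin

lemma lin_span_add:
  assumes "a \<in> lin_span C V" "b \<in> lin_span C V"
  shows "a + b \<in> lin_span C V"
proof -
  obtain c d where "a = (\<Sum>v\<in>V. c v * v)" "b = (\<Sum>v\<in>V. d v * v)" "\<forall>v\<in>V. c v \<in> C \<and> d v \<in> C"
    using assms by (auto simp: lin_span_def)
  thus ?thesis using subring_set_add[OF C] unfolding lin_span_def
    by (intro CollectI exI[of _ "\<lambda>v. c v + d v"]) (auto simp: sum.distrib distrib_right)
qed

lemma lin_span_scale:
  assumes "a \<in> lin_span C V" "k \<in> C"
  shows "k * a \<in> lin_span C V"
proof -
  obtain c where "a = (\<Sum>v\<in>V. c v * v)" "\<forall>v\<in>V. c v \<in> C"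
    using assms by (auto simp: lin_span_def)
  thus ?thesis using subring_set_mult[OF C] assms(2) unfolding lin_span_def
    by (intro CollectI exI[of _ "\<lambda>v. k * c v"]) (auto simp: sum_distrib_left ac_simps)
qed

lemma lin_span_zero: "0 \<in> lin_span C V"
  using subring_set_zero[OF C] unfolding lin_span_def
  by (intro CollectI exI[of _ "\<lambda>v. 0"]) auto

lemma in_lin_span:
  assumes "finite V" "v \<in> V"
  shows "v \<in> lin_span C V"
  using assms subring_set_zero[OF C] subring_set_one[OF C] unfolding lin_span_def
  by (intro CollectI exI[of _ "\<lambda>w. if w = v then 1 else 0"])
     (auto simp: if_distrib[of "\<lambda>x. x * _"] cong: if_cong)

lemma lin_span_sum:
  assumes "\<And>i. i \<in> I \<Longrightarrow> f i \<in> lin_span C V"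
  shows "sum f I \<in> lin_span C V"
  using assms by (induction I rule: infinite_finite_induct) (auto intro: lin_span_add lin_span_zero)

lemma lin_span_mult:
  assumes "finite U" "\<And>v w. v \<in> V \<Longrightarrow> w \<in> W \<Longrightarrow> v * w \<in> U"
    and "a \<in> lin_span C V" "b \<in> lin_span C W"
  shows "a * b \<in> lin_span C U"
proof -
  obtain c d where a: "a = (\<Sum>v\<in>V. c v * v)" "\<forall>v\<in>V. c v \<in> C"
    and b: "b = (\<Sum>w\<in>W. d w * w)" "\<forall>w\<in>W. d w \<in> C"
    using assms(3,4) by (auto simp: lin_span_def)
  have "a * b = (\<Sum>v\<in>V. \<Sum>w\<in>W. c v * (d w * (v * w)))"
    by (simp add: a b sum_product ac_simps)
  also have "\<dots> \<in> lin_span C U"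
    using a b assms(1,2) by (intro lin_span_sum lin_span_scale in_lin_span) auto
  finally show ?thesis .
qed

lemma lin_span_mono:
  assumes "finite U" "V \<subseteq> U" "a \<in> lin_span C V"
  shows "a \<in> lin_span C U"
proof -
  obtain c where a: "a = (\<Sum>v\<in>V. c v * v)" "\<forall>v\<in>V. c v \<in> C"
    using assms(3) by (auto simp: lin_span_def)
  have "c v * v \<in> lin_span C U" if "v \<in> V" for v
    using a(2) assms(1,2) that by (intro lin_span_scale in_lin_span) auto
  thus ?thesis unfolding a(1) by (rule lin_span_sum)
qed

end

text \<open>
  A polynomial ring \<open>B = C[y\<^sub>1, \<dots>, y\<^sub>m]\<close> over a field \<open>C\<close>, inside an ambient field.
\<close>

locale indeterminates =
  fixes C :: "'e::field set" and ys :: "'e list"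
  assumes base_subring: "subring_set C"
    and base_inverse: "\<And>c. c \<in> C \<Longrightarrow> inverse c \<in> C"
    and indep: "indep_tower C ys"
begin

abbreviation B :: "'e set" where "B \<equiv> poly_tower C ys"

lemmas B_subring = subring_poly_tower[OF base_subring, of ys]
lemmas B_induct = poly_tower_induct[OF base_subring, of _ ys, consumes 1, case_names base gen add mult]

lemma base_in_B: "c \<in> C \<Longrightarrow> c \<in> B"
  using base_subset_poly_tower[OF base_subring] by blast

lemma gen_in_B: "y \<in> set ys \<Longrightarrow> y \<in> B"
  using gens_subset_poly_tower[OF base_subring] by blast

text \<open>
  All maps on \<open>B\<close> that are needed come from substitutions \<open>y \<mapsto> z y\<close> with values in the polynomials
  in one further variable \<open>t\<close> over the ambient field: \<open>y \<mapsto> y t\<close> yields the total degree, and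
  \<open>y\<^sub>j \<mapsto> y\<^sub>j + t\<close> yields the partial derivative with respect to \<open>y\<^sub>j\<close>.
\<close>

definition substitute :: "('e \<Rightarrow> 'e poly) \<Rightarrow> 'e \<Rightarrow> 'e poly" where
  "substitute z = (SOME h. hom_on B h \<and> (\<forall>c\<in>C. h c = [:c:]) \<and> (\<forall>y\<in>set ys. h y = z y))"

lemma substitute:
  shows substitute_add: "a \<in> B \<Longrightarrow> b \<in> B \<Longrightarrow> substitute z (a + b) = substitute z a + substitute z b"
    and substitute_mult: "a \<in> B \<Longrightarrow> b \<in> B \<Longrightarrow> substitute z (a * b) = substitute z a * substitute z b"
    and substitute_base: "c \<in> C \<Longrightarrow> substitute z c = [:c:]"
    and substitute_gen: "y \<in> set ys \<Longrightarrow> substitute z y = z y"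
    and substitute_hom: "hom_on B (substitute z)"
proof -
  have "\<exists>h. hom_on B h \<and> (\<forall>c\<in>C. h c = [:c:]) \<and> (\<forall>y\<in>set ys. h y = z y)"
    by (rule extend_hom_on_poly_tower[OF base_subring _ _ indep]) (auto simp: hom_on_def one_pCons)
  from someI_ex[OF this]
  have *: "hom_on B (substitute z) \<and> (\<forall>c\<in>C. substitute z c = [:c:]) \<and>
      (\<forall>y\<in>set ys. substitute z y = z y)"
    unfolding substitute_def .
  show "a \<in> B \<Longrightarrow> b \<in> B \<Longrightarrow> substitute z (a + b) = substitute z a + substitute z b"
    "a \<in> B \<Longrightarrow> b \<in> B \<Longrightarrow> substitute z (a * b) = substitute z a * substitute z b"
    "c \<in> C \<Longrightarrow> substitute z c = [:c:]"
    "y \<in> set ys \<Longrightarrow> substitute z y = z y"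
    "hom_on B (substitute z)"
    using * by (auto simp: hom_on_def)
qed

lemma substitute_zero: "substitute z 0 = 0"
  using substitute_base[OF subring_set_zero[OF base_subring]] by simp

lemma poly_substitute:
  assumes "\<And>y. y \<in> set ys \<Longrightarrow> poly (z y) t = y" "b \<in> B"
  shows "poly (substitute z b) t = b"
  using assms(2)
proof (induction rule: B_induct)
  case (gen y)
  thus ?case using assms(1) by (simp add: substitute_gen)
qed (simp_all add: substitute)

lemma coeff_substitute_in_B:
  assumes "\<And>y i. y \<in> set ys \<Longrightarrow> coeff (z y) i \<in> B" "b \<in> B"
  shows "coeff (substitute z b) i \<in> B"
proof -
  note S = subring_polys_over[OF B_subring]
  have "substitute z b \<in> polys_over B"
    using assms(2)
  proof (induction rule: B_induct)
    case (base c)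
    thus ?case using const_in_polys_over[OF B_subring base_in_B] by (simp add: substitute_base)
  next
    case (gen y)
    thus ?case using assms(1) by (simp add: substitute_gen polys_over_def)
  qed (simp_all add: substitute subring_set_add[OF S] subring_set_mult[OF S])
  thus ?thesis by (rule polys_overD)
qed

text \<open>
  The coefficient of \<open>t\<^sup>k\<close> in \<open>homog b\<close> is the homogeneous component of degree \<open>k\<close> of \<open>b\<close>. So
  \<open>degree (homog b)\<close> is the total degree of \<open>b\<close>, and it is additive on products because the
  coefficients lie in a domain.
\<close>

definition homog :: "'e \<Rightarrow> 'e poly" where
  "homog = substitute (\<lambda>y. [:0, y:])"

lemma poly_homog_1: "b \<in> B \<Longrightarrow> poly (homog b) 1 = b"
  unfolding homog_def by (rule poly_substitute) auto

lemma homog_eq_0_iff: "b \<in> B \<Longrightarrow> homog b = 0 \<longleftrightarrow> b = 0"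
  using poly_homog_1[of b] by (auto simp: homog_def substitute_zero)

lemma coeff_homog_in_B: "b \<in> B \<Longrightarrow> coeff (homog b) i \<in> B"
  unfolding homog_def
  by (rule coeff_substitute_in_B)
     (auto simp: coeff_pCons gen_in_B subring_set_zero[OF B_subring] split: nat.splits)

definition monomials :: "nat \<Rightarrow> 'e set" where
  "monomials k = prod_list ` {zs. set zs \<subseteq> set ys \<and> length zs = k}"

lemma finite_monomials: "finite (monomials k)"
  unfolding monomials_def by (intro finite_imageI finite_lists_length_eq) auto

lemma monomials_mult:
  assumes "v \<in> monomials i" "w \<in> monomials j"
  shows "v * w \<in> monomials (i + j)"
proof -
  obtain zs zs' where "v = prod_list zs" "w = prod_list zs'"
      "set zs \<subseteq> set ys" "set zs' \<subseteq> set ys" "length zs = i" "length zs' = j"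
    using assms by (auto simp: monomials_def)
  thus ?thesis unfolding monomials_def by (intro image_eqI[of _ _ "zs @ zs'"]) auto
qed

lemma monomials_subset_B: "monomials k \<subseteq> B"
  using gen_in_B by (auto simp: monomials_def intro!: subring_set_prod_list[OF B_subring])

lemma coeff_homog_in_span:
  assumes "b \<in> B"
  shows "coeff (homog b) k \<in> lin_span C (monomials k)"
  using assms
proof (induction arbitrary: k rule: B_induct)
  case (base c)
  have "1 \<in> monomials 0" by (auto simp: monomials_def)
  hence "c * 1 \<in> lin_span C (monomials 0)"
    by (intro lin_span_scale[OF base_subring] in_lin_span[OF base_subring] finite_monomials base)
  thus ?case using base lin_span_zero[OF base_subring]
    by (simp add: homog_def substitute_base coeff_pCons split: nat.splits)
next
  case (gen y)
  have "y \<in> monomials (Suc 0)" unfolding monomials_def using gen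
    by (intro image_eqI[of _ _ "[y]"]) auto
  hence "y \<in> lin_span C (monomials (Suc 0))"
    by (intro in_lin_span[OF base_subring] finite_monomials)
  thus ?case using gen lin_span_zero[OF base_subring]
    by (simp add: homog_def substitute_gen coeff_pCons split: nat.splits)
next
  case (add a b)
  thus ?case using lin_span_add[OF base_subring] by (simp add: homog_def substitute_add)
next
  case (mult a b)
  have "coeff (homog a) i * coeff (homog b) (k - i) \<in> lin_span C (monomials k)" if "i \<le> k" for i
    using lin_span_mult[OF base_subring finite_monomials _ mult.IH(1) mult.IH(2), of i "k - i" k]
      monomials_mult[of _ i _ "k - i"] that by simp
  thus ?case using mult lin_span_sum[OF base_subring, of "{..k}"]
    by (simp add: homog_def substitute_mult coeff_mult)
qed

lemma bounded_degree_in_span: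
  assumes b: "b \<in> B" and d: "degree (homog b) \<le> d"
  shows "b \<in> lin_span C (\<Union>k\<le>d. monomials k)"
proof -
  have "b = (\<Sum>k\<le>degree (homog b). coeff (homog b) k)"
    using poly_homog_1[OF b] by (simp add: poly_altdef)
  also have "\<dots> \<in> lin_span C (\<Union>k\<le>d. monomials k)"
  proof (rule lin_span_sum[OF base_subring])
    fix k assume "k \<in> {..degree (homog b)}"
    hence "monomials k \<subseteq> (\<Union>k\<le>d. monomials k)" using d by (intro UN_upper) simp
    thus "coeff (homog b) k \<in> lin_span C (\<Union>k\<le>d. monomials k)"
      using lin_span_mono[OF base_subring _ _ coeff_homog_in_span[OF b]] finite_monomials by blast
  qed
  finally show ?thesis .
qed

text \<open>
  The linear Taylor coefficient of \<open>b\<close> in the direction \<open>j\<close>.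
\<close>

definition partial :: "'e \<Rightarrow> 'e \<Rightarrow> 'e" where
  "partial j b = coeff (substitute (\<lambda>y. [:y, if y = j then 1 else 0:]) b) 1"

lemma partial_in_B: "b \<in> B \<Longrightarrow> partial j b \<in> B"
  unfolding partial_def
  by (rule coeff_substitute_in_B)
     (auto simp: coeff_pCons gen_in_B subring_setD[OF B_subring] split: nat.splits)

lemma partial_base: "c \<in> C \<Longrightarrow> partial j c = 0"
  by (simp add: partial_def substitute_base)

lemma partial_gen: "y \<in> set ys \<Longrightarrow> partial j y = (if y = j then 1 else 0)"
  by (simp add: partial_def substitute_gen)

lemma partial_add: "a \<in> B \<Longrightarrow> b \<in> B \<Longrightarrow> partial j (a + b) = partial j a + partial j b"
  by (simp add: partial_def substitute_add)

lemma partial_mult: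
  assumes "a \<in> B" "b \<in> B"
  shows "partial j (a * b) = partial j a * b + a * partial j b"
proof -
  let ?s = "substitute (\<lambda>y. [:y, if y = j then 1 else 0:])"
  have "coeff (?s b) 0 = b" if "b \<in> B" for b
    using poly_substitute[of "\<lambda>y. [:y, if y = j then 1 else 0:]" 0 b] that
    by (simp add: poly_0_coeff_0)
  thus ?thesis using assms by (simp add: partial_def substitute_mult coeff_mult)
qed

lemma partial_zero: "partial j 0 = 0"
  by (simp add: partial_base subring_set_zero[OF base_subring])

lemma partial_sum:
  assumes "\<And>i. i \<in> I \<Longrightarrow> f i \<in> B"
  shows "partial j (sum f I) = (\<Sum>i\<in>I. partial j (f i))"
  using assms
proof (induction I rule: infinite_finite_induct)
  case (insert i I)
  thus ?case using subring_set_sum[OF B_subring, of I f] by (simp add: partial_add)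
qed (auto simp: partial_zero)

text \<open>
  Partial differentiation lowers the degree of each homogeneous component by one. Both sides are
  derivations along \<open>homog\<close>, hence they agree as soon as they agree on coefficients and
  indeterminates.
\<close>

lemma map_poly_partial_homog:
  assumes "b \<in> B"
  shows "map_poly (partial j) (homog b) = pCons 0 (homog (partial j b))"
  using assms
proof (induction rule: B_induct)
  case (base c)
  thus ?case by (simp add: homog_def substitute_base partial_base substitute_zero map_poly_pCons partial_zero)
next
  case (gen y)
  have "homog (partial j y) = [:partial j y:]"
    using gen subring_setD[OF base_subring] by (auto simp: homog_def partial_gen substitute_base)
  thus ?case using gen by (simp add: homog_def substitute_gen map_poly_pCons partial_zero)
next
  case (add a b)
  have "map_poly (partial j) (homog a + homog b) = map_poly (partial j) (homog a) + map_poly (partial j) (homog b)"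
    using add.hyps by (intro poly_eqI) (simp add: coeff_map_poly partial_zero partial_add coeff_homog_in_B)
  thus ?case using add by (simp add: homog_def substitute_add partial_add partial_in_B)
next
  case (mult a b)
  have "map_poly (partial j) (homog a * homog b) =
      map_poly (partial j) (homog a) * homog b + homog a * map_poly (partial j) (homog b)"
  proof (rule poly_eqI)
    fix n
    have "partial j (\<Sum>i\<le>n. coeff (homog a) i * coeff (homog b) (n - i)) =
        (\<Sum>i\<le>n. partial j (coeff (homog a) i) * coeff (homog b) (n - i) +
          coeff (homog a) i * partial j (coeff (homog b) (n - i)))"
      using mult.hyps
      by (subst partial_sum) (auto simp: partial_mult coeff_homog_in_B subring_set_mult[OF B_subring])
    thus "coeff (map_poly (partial j) (homog a * homog b)) n =
        coeff (map_poly (partial j) (homog a) * homog b + homog a * map_poly (partial j) (homog b)) n"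
      by (simp add: coeff_map_poly partial_zero coeff_mult sum.distrib)
  qed
  thus ?case using mult
    by (simp add: homog_def substitute_add substitute_mult partial_mult partial_in_B
        subring_set_mult[OF B_subring])
qed

lemma degree_partial_less:
  assumes b: "b \<in> B" and "partial j b \<noteq> 0"
  shows "degree (homog (partial j b)) < degree (homog b)"
proof -
  have "homog (partial j b) \<noteq> 0" using assms partial_in_B homog_eq_0_iff by blast
  hence "Suc (degree (homog (partial j b))) = degree (map_poly (partial j) (homog b))"
    by (simp add: map_poly_partial_homog[OF b])
  also have "\<dots> \<le> degree (homog b)"
    by (intro degree_le allI impI) (simp add: coeff_map_poly partial_zero coeff_eq_0)
  finally show ?thesis by simp
qed

text \<open>
  The chain rule: a derivation of the ambient field is determined on \<open>B\<close> by its values on \<open>C\<close> and on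
  the indeterminates.
\<close>

lemma derivation_eq_partial:
  assumes \<delta>: "derivation \<delta>" and C0: "\<And>c. c \<in> C \<Longrightarrow> \<delta> c = 0" and b: "b \<in> B"
  shows "\<delta> b = (\<Sum>y\<in>set ys. \<delta> y * partial y b)"
  using b
proof (induction rule: B_induct)
  case (base c)
  thus ?case by (simp add: C0 partial_base)
next
  case (gen y)
  have "(\<Sum>x\<in>set ys. \<delta> x * partial x y) = (\<Sum>x\<in>set ys. if y = x then \<delta> x else 0)"
    using gen by (intro sum.cong) (auto simp: partial_gen)
  thus ?case using gen by simp
next
  case (add a b)
  thus ?case by (simp add: derivation_add[OF \<delta>] partial_add distrib_left sum.distrib)
next
  case (mult a b)
  have "\<delta> (a * b) = (\<Sum>y\<in>set ys. \<delta> y * partial y a) * b + a * (\<Sum>y\<in>set ys. \<delta> y * partial y b)"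
    using mult by (simp add: derivation_mult[OF \<delta>])
  also have "\<dots> = (\<Sum>y\<in>set ys. \<delta> y * partial y (a * b))"
    using mult.hyps
    by (simp add: partial_mult sum_distrib_left sum_distrib_right sum.distrib algebra_simps)
  finally show ?case .
qed

text \<open>
  The commutator of the derivations \<open>partial j\<close> and \<open>\<delta>\<close> is again a derivation on \<open>B\<close> that kills \<open>C\<close>;
  its value on an indeterminate \<open>y\<close> is \<open>partial j (\<delta> y)\<close>, because \<open>partial j y\<close> is \<open>0\<close> or \<open>1\<close>.
\<close>

lemma commutator_partial:
  assumes \<delta>: "derivation \<delta>" and C0: "\<And>c. c \<in> C \<Longrightarrow> \<delta> c = 0" and \<delta>B: "\<delta> ` B \<subseteq> B" and b: "b \<in> B"
  shows "\<delta> (partial j b) = partial j (\<delta> b) - (\<Sum>y\<in>set ys. partial j (\<delta> y) * partial y b)"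
proof -
  have "partial j (\<delta> b) - \<delta> (partial j b) = (\<Sum>y\<in>set ys. partial j (\<delta> y) * partial y b)"
    using b
  proof (induction rule: B_induct)
    case (base c)
    thus ?case by (simp add: C0 partial_base partial_zero derivation_zero[OF \<delta>])
  next
    case (gen y)
    have "(\<Sum>x\<in>set ys. partial j (\<delta> x) * partial x y) =
        (\<Sum>x\<in>set ys. if y = x then partial j (\<delta> x) else 0)"
      using gen by (intro sum.cong) (auto simp: partial_gen)
    thus ?case using gen by (simp add: partial_gen derivation_zero[OF \<delta>] derivation_one[OF \<delta>])
  next
    case (add a b)
    have "\<delta> a \<in> B" "\<delta> b \<in> B" using add.hyps \<delta>B by auto
    thus ?case using add
      by (simp add: derivation_add[OF \<delta>] partial_add distrib_left sum.distrib algebra_simps)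
  next
    case (mult a b)
    have \<delta>ab: "\<delta> a \<in> B" "\<delta> b \<in> B" using mult.hyps \<delta>B by auto
    have "partial j (\<delta> (a * b)) - \<delta> (partial j (a * b)) =
        (partial j (\<delta> a) - \<delta> (partial j a)) * b + a * (partial j (\<delta> b) - \<delta> (partial j b))"
      using mult.hyps \<delta>ab
      by (simp add: derivation_mult[OF \<delta>] derivation_add[OF \<delta>] partial_mult partial_add
          subring_set_mult[OF B_subring] partial_in_B algebra_simps)
    also have "\<dots> = (\<Sum>y\<in>set ys. partial j (\<delta> y) * partial y (a * b))"
      using mult
      by (simp add: partial_mult sum_distrib_left sum_distrib_right sum.distrib algebra_simps)
    finally show ?case .
  qed
  thus ?thesis by (simp add: algebra_simps)
qed

lemma degree_derivation_le:
  assumes \<delta>: "derivation \<delta>" and C0: "\<And>c. c \<in> C \<Longrightarrow> \<delta> c = 0" and \<delta>B: "\<delta> ` B \<subseteq> B"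
  obtains d where "\<And>b. b \<in> B \<Longrightarrow> degree (homog (\<delta> b)) \<le> degree (homog b) + d"
proof -
  define d where "d = (\<Sum>y\<in>set ys. degree (homog (\<delta> y)))"
  have "degree (homog (\<delta> b)) \<le> degree (homog b) + d" if b: "b \<in> B" for b
  proof -
    have in_B: "\<delta> y \<in> B" "partial y b \<in> B" if "y \<in> set ys" for y
      using \<delta>B gen_in_B[OF that] partial_in_B[OF b] by auto
    have "homog (\<delta> b) = (\<Sum>y\<in>set ys. homog (\<delta> y) * homog (partial y b))"
      unfolding homog_def
      by (subst derivation_eq_partial[OF \<delta> C0 b], assumption, subst hom_on_sum[OF B_subring substitute_hom])
         (use in_B in \<open>auto intro: subring_set_mult[OF B_subring] simp: substitute_mult\<close>)
    also have "degree \<dots> \<le> degree (homog b) + d"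
    proof (intro degree_sum_le)
      fix y assume y: "y \<in> set ys"
      have "degree (homog (\<delta> y) * homog (partial y b)) \<le>
          degree (homog (\<delta> y)) + degree (homog (partial y b))"
        by (rule degree_mult_le)
      also have "degree (homog (\<delta> y)) \<le> d" unfolding d_def using y by (intro member_le_sum) auto
      also have "degree (homog (partial y b)) \<le> degree (homog b)"
        using degree_partial_less[OF b, of y]
        by (cases "partial y b = 0") (auto simp: homog_def substitute_zero)
      finally show "degree (homog (\<delta> y) * homog (partial y b)) \<le> degree (homog b) + d" by simp
    qed auto
    finally show ?thesis .
  qed
  thus ?thesis using that by blast
qed

lemma degree_homog_mult:
  assumes "a \<in> B" "b \<in> B" "a \<noteq> 0" "b \<noteq> 0"
  shows "degree (homog (a * b)) = degree (homog a) + degree (homog b)"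
  using assms homog_eq_0_iff by (simp add: homog_def substitute_mult degree_mult_eq)

section \<open>Invariant primes of a derivation\<close>

text \<open>
  A derivation raises degrees by a bounded amount \<open>d\<close>, whence the quotient \<open>\<delta> p / p\<close>, when it is a
  polynomial, has degree at most \<open>d\<close>. So the cofactors \<open>k\<close> of all invariant polynomials \<open>p\<close> lie in the
  span of the finitely many monomials of degree at most \<open>d\<close>.
\<close>

lemma cofactors_in_finite_span:
  assumes \<delta>: "derivation \<delta>" and C0: "\<And>c. c \<in> C \<Longrightarrow> \<delta> c = 0" and \<delta>B: "\<delta> ` B \<subseteq> B"
  obtains V where "finite V" "V \<subseteq> B"
    "\<And>p k. p \<in> B \<Longrightarrow> p \<noteq> 0 \<Longrightarrow> k \<in> B \<Longrightarrow> \<delta> p = p * k \<Longrightarrow> k \<in> lin_span C V"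
proof -
  obtain d where d: "\<And>b. b \<in> B \<Longrightarrow> degree (homog (\<delta> b)) \<le> degree (homog b) + d"
    using degree_derivation_le[OF \<delta> C0 \<delta>B] by blast
  have "k \<in> lin_span C (\<Union>k\<le>d. monomials k)"
    if p: "p \<in> B" "p \<noteq> 0" and k: "k \<in> B" "\<delta> p = p * k" for p k
  proof (cases "k = 0")
    case True
    thus ?thesis using lin_span_zero[OF base_subring] by simp
  next
    case False
    hence "degree (homog k) \<le> d" using d[OF p(1)] degree_homog_mult[OF p(1) k(1) p(2)] k(2) by simp
    thus ?thesis by (rule bounded_degree_in_span[OF k(1)])
  qed
  thus ?thesis using that[of "\<Union>k\<le>d. monomials k"] finite_monomials monomials_subset_B by blast
qed

text \<open>
  Logarithmic derivatives of non-associated primes have poles along different divisors and cannot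
  cancel. After multiplication by the product of all primes of \<open>S\<close>, every summand except that of \<open>q\<close>
  is divisible by \<open>q\<close>; so \<open>q\<close> divides \<open>partial j q\<close>, which is impossible for degree reasons
  unless \<open>partial j q = 0\<close>.
\<close>

lemma log_derivative_relation_trivial:
  assumes fin: "finite S" and S: "\<And>p. p \<in> S \<Longrightarrow> prime_in B p"
    and nonassoc: "\<And>p q. p \<in> S \<Longrightarrow> q \<in> S \<Longrightarrow> p \<noteq> q \<Longrightarrow> \<not> dvd_in B p q"
    and c: "\<And>p. p \<in> S \<Longrightarrow> c p \<in> C"
    and rel: "(\<Sum>p\<in>S. c p * (partial j p / p)) = 0"
    and q: "q \<in> S" "c q \<noteq> 0"
  shows "partial j q = 0"
proof -
  note prime = S[OF q(1)]
  define \<pi> where "\<pi> Y = prod (\<lambda>p. p) Y" for Y :: "'e set"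
  have prod_remove: "\<pi> Y = p * \<pi> (Y - {p})" if "finite Y" "p \<in> Y" for Y p
    unfolding \<pi>_def using that by (rule prod.remove)
  have S_B: "p \<in> B" "p \<noteq> 0" if "p \<in> S" for p using prime_inD[OF S[OF that]] by auto
  have summand: "c p * (partial j p / p) * \<pi> S = c p * partial j p * \<pi> (S - {p})" if "p \<in> S" for p
    using prod_remove[OF fin that] S_B[OF that] by simp
  have prod_B: "\<pi> Y \<in> B" if "Y \<subseteq> S" for Y
    unfolding \<pi>_def using that S_B by (intro subring_set_prod[OF B_subring]) auto
  have "0 = (\<Sum>p\<in>S. c p * (partial j p / p) * \<pi> S)"
    using rel unfolding sum_distrib_right[symmetric] by simp
  also have "\<dots> = (\<Sum>p\<in>S. c p * partial j p * \<pi> (S - {p}))"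
    by (intro sum.cong refl summand)
  also have "\<dots> = c q * partial j q * \<pi> (S - {q}) + (\<Sum>p\<in>S - {q}. c p * partial j p * \<pi> (S - {p}))"
    using fin q(1) by (rule sum.remove)
  finally have eq: "c q * partial j q * \<pi> (S - {q}) = - (\<Sum>p\<in>S - {q}. c p * partial j p * \<pi> (S - {p}))"
    by (simp add: eq_neg_iff_add_eq_0)
  have "dvd_in B q (- (\<Sum>p\<in>S - {q}. c p * partial j p * \<pi> (S - {p})))"
  proof (intro dvd_in_minus dvd_in_sum B_subring)
    fix p assume p: "p \<in> S - {q}"
    have "\<pi> (S - {p}) = q * \<pi> (S - {p} - {q})" using fin q(1) p by (intro prod_remove) auto
    hence "c p * partial j p * \<pi> (S - {p}) = q * (c p * partial j p * \<pi> (S - {p} - {q}))" by simp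
    moreover have "c p * partial j p * \<pi> (S - {p} - {q}) \<in> B"
      using p by (intro subring_set_mult[OF B_subring] prod_B base_in_B c partial_in_B S_B) auto
    ultimately show "dvd_in B q (c p * partial j p * \<pi> (S - {p}))"
      using dvd_in_triv[OF B_subring] by metis
  qed
  hence "dvd_in B q (c q * partial j q * \<pi> (S - {q}))" using eq by simp
  hence "dvd_in B q (c q * partial j q) \<or> dvd_in B q (\<pi> (S - {q}))"
    using q by (intro prime_inD(4)[OF prime] subring_set_mult[OF B_subring] base_in_B c partial_in_B S_B prod_B) auto
  moreover have "\<not> dvd_in B q (\<pi> Y)" if "finite Y" "Y \<subseteq> S - {q}" for Y
    using that
  proof (induction Y rule: finite_induct)
    case empty
    thus ?case using prime_inD(3)[OF prime] by (simp add: \<pi>_def)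
  next
    case (insert x Y)
    have "\<pi> (insert x Y) = x * \<pi> Y" using insert.hyps by (simp add: \<pi>_def)
    thus ?case
      using insert prime_inD(4)[OF prime, of x "\<pi> Y"] prod_B[of Y] S_B nonassoc[OF q(1), of x] by auto
  qed
  ultimately have "dvd_in B q (c q * partial j q)" using fin by blast
  hence "dvd_in B q (c q) \<or> dvd_in B q (partial j q)"
    using q by (intro prime_inD(4)[OF prime] base_in_B c partial_in_B S_B) auto
  moreover have "\<not> dvd_in B q (c q)"
  proof
    assume "dvd_in B q (c q)"
    hence "dvd_in B q (c q * inverse (c q))"
      by (intro dvd_in_mult[OF B_subring] base_in_B base_inverse c q)
    thus False using q(2) prime_inD(3)[OF prime] by simp
  qed
  ultimately obtain m where m: "m \<in> B" "partial j q = q * m" by (auto simp: dvd_in_def)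
  show ?thesis
  proof (rule ccontr)
    assume "partial j q \<noteq> 0"
    moreover from this have "m \<noteq> 0" using m(2) by auto
    ultimately show False
      using degree_partial_less[OF S_B(1)[OF q(1)], of j] degree_homog_mult[OF S_B(1)[OF q(1)] m(1)]
        S_B(2)[OF q(1)] m(2) by simp
  qed
qed

text \<open>
  Jouanolou's finiteness theorem, with the bound \<open>N\<close> equal to the number of indeterminates plus the
  dimension bound for the space of cofactors. To an invariant prime \<open>p\<close> with
  \<open>\<delta> p = p * (\<Sum>v\<in>V. \<kappa> p v * v)\<close> belongs the vector \<open>u p\<close> with the entries \<open>partial j p / p\<close> and
  \<open>\<kappa> p v\<close>. Applying \<open>partial j\<close> to that equation and commuting \<open>partial j\<close> with \<open>\<delta>\<close> gives
  \<open>\<delta> (partial j p / p) = (\<Sum>v\<in>V. \<kappa> p v * partial j v) - (\<Sum>y\<in>set ys. partial j (\<delta> y) * (partial y p / p))\<close>,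
  which is linear in \<open>u p\<close> with coefficients that do not depend on \<open>p\<close>, while the entries \<open>\<kappa> p v\<close>
  are constants. More than \<open>N\<close> such vectors are therefore linearly dependent over the constants.
\<close>

theorem finitely_many_invariant_primes:
  assumes \<delta>: "derivation \<delta>" and \<delta>B: "\<delta> ` B \<subseteq> B" and const: "constants \<delta> UNIV = C"
  obtains N where "\<And>S. finite S \<Longrightarrow> (\<And>p. p \<in> S \<Longrightarrow> prime_in B p \<and> dvd_in B p (\<delta> p)) \<Longrightarrow>
    (\<And>p q. p \<in> S \<Longrightarrow> q \<in> S \<Longrightarrow> p \<noteq> q \<Longrightarrow> \<not> dvd_in B p q) \<Longrightarrow> card S \<le> N"
proof -
  have C_iff: "c \<in> C \<longleftrightarrow> \<delta> c = 0" for c using const by (auto simp: constants_def)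
  hence C0: "\<delta> c = 0" if "c \<in> C" for c using that by blast
  obtain V where V: "finite V" "V \<subseteq> B"
    "\<And>p k. p \<in> B \<Longrightarrow> p \<noteq> 0 \<Longrightarrow> k \<in> B \<Longrightarrow> \<delta> p = p * k \<Longrightarrow> k \<in> lin_span C V"
    using cofactors_in_finite_span[OF \<delta> C0 \<delta>B] by blast
  define I where "I = Sum_Type.Plus (set ys) V"
  have finI: "finite I" using V(1) by (simp add: I_def)
  have "card S \<le> card I"
    if fin: "finite S" and S: "\<And>p. p \<in> S \<Longrightarrow> prime_in B p \<and> dvd_in B p (\<delta> p)"
      and nonassoc: "\<And>p q. p \<in> S \<Longrightarrow> q \<in> S \<Longrightarrow> p \<noteq> q \<Longrightarrow> \<not> dvd_in B p q" for S
  proof (rule ccontr)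
    assume "\<not> card S \<le> card I"
    hence card: "card I < card S" by simp
    have S_B: "p \<in> B" "p \<noteq> 0" if "p \<in> S" for p using S[OF that] prime_inD by auto
    have "\<exists>\<kappa>. (\<forall>v\<in>V. \<kappa> v \<in> C) \<and> (\<Sum>v\<in>V. \<kappa> v * v) \<in> B \<and> \<delta> p = p * (\<Sum>v\<in>V. \<kappa> v * v)"
      if p: "p \<in> S" for p
    proof -
      obtain k where k: "k \<in> B" "\<delta> p = p * k" using S[OF p] by (auto simp: dvd_in_def)
      hence "k \<in> lin_span C V" using V(3) S_B[OF p] by blast
      thus ?thesis using k by (auto simp: lin_span_def)
    qed
    then obtain \<kappa> where \<kappa>: "\<And>p v. p \<in> S \<Longrightarrow> v \<in> V \<Longrightarrow> \<kappa> p v \<in> C"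
      "\<And>p. p \<in> S \<Longrightarrow> (\<Sum>v\<in>V. \<kappa> p v * v) \<in> B"
      "\<And>p. p \<in> S \<Longrightarrow> \<delta> p = p * (\<Sum>v\<in>V. \<kappa> p v * v)" by metis
    \<comment> \<open>The summands of the index type stand for the indeterminates and for the spanning set of cofactors.\<close>
    define u where "u p = case_sum (\<lambda>j. partial j p / p) (\<kappa> p)" for p
    define M :: "'e + 'e \<Rightarrow> 'e + 'e \<Rightarrow> 'e" where "M = case_sum
      (\<lambda>j. case_sum (\<lambda>y. - partial j (\<delta> y)) (\<lambda>v. partial j v)) (\<lambda>_ _. 0)"
    have "\<delta> (u p i) = (\<Sum>l\<in>I. M i l * u p l)" if p: "p \<in> S" and i: "i \<in> I" for p i
    proof (cases i)
      case (Inr v)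
      thus ?thesis using i \<kappa>(1)[OF p] by (auto simp: I_def u_def M_def C0)
    next
      case (Inl j)
      let ?k = "\<Sum>v\<in>V. \<kappa> p v * v"
      have "partial j ?k = (\<Sum>v\<in>V. partial j (\<kappa> p v * v))"
        using V(2) \<kappa>(1)[OF p] base_in_B by (intro partial_sum subring_set_mult[OF B_subring]) auto
      also have "\<dots> = (\<Sum>v\<in>V. partial j v * \<kappa> p v)"
      proof (intro sum.cong refl)
        fix v assume v: "v \<in> V"
        have "v \<in> B" using v V(2) by blast
        thus "partial j (\<kappa> p v * v) = partial j v * \<kappa> p v"
          using \<kappa>(1)[OF p v] by (simp add: partial_mult base_in_B partial_base)
      qed
      finally have pk: "partial j ?k = (\<Sum>v\<in>V. partial j v * \<kappa> p v)" .
      have "partial j (\<delta> p) = partial j p * ?k + p * partial j ?k"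
        unfolding \<kappa>(3)[OF p] by (rule partial_mult[OF S_B(1)[OF p] \<kappa>(2)[OF p]])
      moreover have comm: "\<delta> (partial j p) = partial j (\<delta> p) - (\<Sum>y\<in>set ys. partial j (\<delta> y) * partial y p)"
        by (rule commutator_partial[OF \<delta> C0 \<delta>B S_B(1)[OF p]])
      ultimately have "\<delta> (partial j p / p) = partial j ?k - (\<Sum>y\<in>set ys. partial j (\<delta> y) * partial y p) / p"
        using S_B(2)[OF p]
        by (simp add: derivation_divide[OF \<delta> S_B(2)[OF p]] comm \<kappa>(3)[OF p] field_simps)
      also have "\<dots> = (\<Sum>l\<in>I. M i l * u p l)"
        using V(1) by (simp add: Inl I_def sum.Plus M_def u_def pk sum_divide_distrib sum_negf)
      finally show ?thesis by (simp add: Inl u_def)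
    qed
    then obtain c where c: "\<And>p. p \<in> S \<Longrightarrow> \<delta> (c p) = 0" "\<exists>p\<in>S. c p \<noteq> 0"
      "\<And>i. i \<in> I \<Longrightarrow> (\<Sum>p\<in>S. c p * u p i) = 0"
      using linear_differential_system_dependent[OF \<delta> finI fin card, of u M] by blast
    then obtain q where q: "q \<in> S" "c q \<noteq> 0" by blast
    \<comment> \<open>If all partial derivatives of \<open>q\<close> vanish, then \<open>q\<close> is a constant, that is, a unit of \<open>B\<close>.\<close>
    have "partial j q = 0" if "j \<in> set ys" for j
    proof (rule log_derivative_relation_trivial[where c = c, OF fin _ nonassoc _ _ q])
      show "(\<Sum>p\<in>S. c p * (partial j p / p)) = 0"
        using c(3)[of "Inl j"] that InlI[OF that, of V] by (simp add: I_def u_def)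
    qed (use S c(1) C_iff in auto)
    hence "\<delta> q = 0" using derivation_eq_partial[OF \<delta> C0 S_B(1)[OF q(1)]] by simp
    hence "q \<in> C" using C_iff by blast
    hence "dvd_in B q (q * inverse q)"
      by (intro dvd_in_triv[OF B_subring] base_in_B base_inverse)
    thus False using S[OF q(1)] prime_inD(2,3)[of B q] by simp
  qed
  thus ?thesis using that[of "card I"] by blast
qed

end

section \<open>Algebraically independent families\<close>

definition power_product :: "('i \<Rightarrow> 'a::comm_ring_1) \<Rightarrow> ('i \<Rightarrow>\<^sub>0 nat) \<Rightarrow> 'a" where
  "power_product x m = (\<Prod>i\<in>Poly_Mapping.keys m. x i ^ Poly_Mapping.lookup m i)"

lemma mpoly_eval_superset:
  assumes "finite S" "Poly_Mapping.keys p \<subseteq> S"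
  shows "mpoly_eval x p = (\<Sum>m\<in>S. Poly_Mapping.lookup p m * power_product x m)"
  unfolding mpoly_eval_def power_product_def using assms
  by (intro sum.mono_neutral_left) (auto simp: in_keys_iff)

lemma mpoly_eval_add: "mpoly_eval x (p + q) = mpoly_eval x p + mpoly_eval x q"
proof -
  let ?S = "Poly_Mapping.keys p \<union> Poly_Mapping.keys q"
  have "mpoly_eval x r = (\<Sum>m\<in>?S. Poly_Mapping.lookup r m * power_product x m)"
    if "Poly_Mapping.keys r \<subseteq> ?S" for r
    using that by (intro mpoly_eval_superset) auto
  thus ?thesis using keys_add[of p q] by (simp add: lookup_add distrib_right sum.distrib)
qed

lemma mpoly_eval_single: "mpoly_eval x (Poly_Mapping.single m c) = c * power_product x m"
  by (subst mpoly_eval_superset[of "{m}"]) auto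

lemma mpoly_eval_zero: "mpoly_eval x 0 = 0"
  by (simp add: mpoly_eval_def)

lemma mpoly_eval_sum: "mpoly_eval x (sum p I) = (\<Sum>i\<in>I. mpoly_eval x (p i))"
  by (induction I rule: infinite_finite_induct) (auto simp: mpoly_eval_add mpoly_eval_zero)

lemma power_product_times_new:
  assumes "i \<notin> Poly_Mapping.keys m"
  shows "power_product x (m + Poly_Mapping.single i k) = power_product x m * x i ^ k"
proof (cases "k = 0")
  case True
  thus ?thesis by simp
next
  case False
  have "Poly_Mapping.keys (m + Poly_Mapping.single i k) = insert i (Poly_Mapping.keys m)"
    using False by (auto simp: in_keys_iff lookup_add lookup_single when_def split: if_splits)
  moreover have "(\<Prod>l\<in>Poly_Mapping.keys m. x l ^ Poly_Mapping.lookup (m + Poly_Mapping.single i k) l) =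
      power_product x m"
    unfolding power_product_def using assms
    by (intro prod.cong) (auto simp: lookup_add lookup_single when_def)
  moreover have "Poly_Mapping.lookup (m + Poly_Mapping.single i k) i = k"
    using assms by (simp add: lookup_add in_keys_iff)
  ultimately show ?thesis using assms by (simp add: power_product_def mult.commute)
qed

text \<open>
  A polynomial in \<open>x i\<close> whose coefficients \<open>r k\<close> are polynomials in the other indeterminates is a
  polynomial \<open>q\<close> in all of them. The exponents \<open>m + single i k\<close> are pairwise distinct, as \<open>m\<close> does
  not involve \<open>i\<close>; thus no terms are collected, and \<open>q = 0\<close> only if all \<open>r k\<close> vanish.
\<close>

lemma poly_over_ring_adjoin:
  assumes p: "p \<in> polys_over (ring_adjoin K J x)" and i: "i \<notin> J"
  obtains q where "q \<in> mpolys K (insert i J)" "mpoly_eval x q = poly p (x i)" "q = 0 \<Longrightarrow> p = 0"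
proof -
  have "\<forall>k. \<exists>r. r \<in> mpolys K J \<and> coeff p k = mpoly_eval x r"
    using polys_overD[OF p] by (auto simp: ring_adjoin_def)
  then obtain r where r: "\<And>k. r k \<in> mpolys K J" "\<And>k. coeff p k = mpoly_eval x (r k)" by metis
  let ?T = "Sigma {..degree p} (\<lambda>k. Poly_Mapping.keys (r k))"
  define e where "e = (\<lambda>(k :: nat, m). m + Poly_Mapping.single i k)"
  define q where "q = (\<Sum>(k, m)\<in>?T. Poly_Mapping.single (e (k, m)) (Poly_Mapping.lookup (r k) m))"
  have fin: "finite ?T" by auto
  have new: "i \<notin> Poly_Mapping.keys m" if "m \<in> Poly_Mapping.keys (r k)" for k m
    using r(1)[of k] that i by (auto simp: mpolys_def)
  have "inj_on e ?T"
  proof (rule inj_onI, clarify)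
    fix k m k' m' assume km: "m \<in> Poly_Mapping.keys (r k)" "m' \<in> Poly_Mapping.keys (r k')"
      and eq: "e (k, m) = e (k', m')"
    have "Poly_Mapping.lookup (e (k, m)) i = k" "Poly_Mapping.lookup (e (k', m')) i = k'"
      using new[OF km(1)] new[OF km(2)] by (auto simp: e_def lookup_add in_keys_iff)
    hence "k = k'" using eq by simp
    thus "k = k' \<and> m = m'" using eq by (simp add: e_def)
  qed
  have lookup_q: "Poly_Mapping.lookup q (e (k, m)) = Poly_Mapping.lookup (r k) m" if "(k, m) \<in> ?T" for k m
  proof -
    have "Poly_Mapping.lookup q (e (k, m)) =
        (\<Sum>t\<in>?T. if t = (k, m) then Poly_Mapping.lookup (r (fst t)) (snd t) else 0)"
      unfolding q_def lookup_sum
    proof (rule sum.cong)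
      fix t assume t: "t \<in> ?T"
      thus "Poly_Mapping.lookup (case t of (k, m) \<Rightarrow> Poly_Mapping.single (e (k, m)) (Poly_Mapping.lookup (r k) m)) (e (k, m)) =
          (if t = (k, m) then Poly_Mapping.lookup (r (fst t)) (snd t) else 0)"
        using inj_onD[OF \<open>inj_on e ?T\<close> _ t that]
        by (cases t) (auto simp: lookup_single when_def)
    qed simp
    thus ?thesis using fin that by simp
  qed
  have keys_q: "Poly_Mapping.keys q \<subseteq> e ` ?T"
  proof
    fix m' assume "m' \<in> Poly_Mapping.keys q"
    hence "(\<Sum>(k, m)\<in>?T. Poly_Mapping.lookup (Poly_Mapping.single (e (k, m)) (Poly_Mapping.lookup (r k) m)) m') \<noteq> 0"
      by (simp add: q_def in_keys_iff lookup_sum case_prod_unfold)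
    then obtain t where "t \<in> ?T" "(case t of (k, m) \<Rightarrow> Poly_Mapping.lookup (Poly_Mapping.single (e (k, m)) (Poly_Mapping.lookup (r k) m)) m') \<noteq> 0"
      by (rule sum.not_neutral_contains_not_neutral)
    thus "m' \<in> e ` ?T" by (cases t) (auto simp: lookup_single when_def split: if_splits)
  qed
  have "q \<in> mpolys K (insert i J)"
    unfolding mpolys_def
  proof (intro CollectI ballI)
    fix m' assume "m' \<in> Poly_Mapping.keys q"
    then obtain k m where km: "(k, m) \<in> ?T" "m' = e (k, m)" using keys_q by auto
    hence "Poly_Mapping.lookup (r k) m \<in> K" "Poly_Mapping.keys m \<subseteq> J"
      using r(1)[of k] by (auto simp: mpolys_def)
    moreover have "Poly_Mapping.keys m' \<subseteq> Poly_Mapping.keys m \<union> {i}"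
      unfolding km(2) e_def using keys_add[of m "Poly_Mapping.single i k"] by (auto split: if_splits)
    ultimately show "Poly_Mapping.lookup q m' \<in> K \<and> Poly_Mapping.keys m' \<subseteq> insert i J"
      using lookup_q[OF km(1)] km(2) by auto
  qed
  moreover have "mpoly_eval x q = poly p (x i)"
  proof -
    have "mpoly_eval x q = (\<Sum>t\<in>?T. Poly_Mapping.lookup (r (fst t)) (snd t) * power_product x (snd t) * x i ^ fst t)"
      unfolding q_def mpoly_eval_sum using new
      by (intro sum.cong) (auto simp: mpoly_eval_single e_def power_product_times_new)
    also have "\<dots> = (\<Sum>k\<le>degree p. \<Sum>m\<in>Poly_Mapping.keys (r k). Poly_Mapping.lookup (r k) m * power_product x m * x i ^ k)"
      by (subst sum.Sigma) (auto simp: case_prod_unfold)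
    also have "\<dots> = (\<Sum>k\<le>degree p. coeff p k * x i ^ k)"
      by (simp add: r(2) mpoly_eval_def power_product_def sum_distrib_right)
    finally show ?thesis by (simp add: poly_altdef)
  qed
  moreover have "p = 0" if "q = 0"
  proof (rule poly_eqI)
    fix k
    show "coeff p k = coeff 0 k"
    proof (cases "k \<le> degree p")
      case True
      have "Poly_Mapping.keys (r k) = {}"
      proof (rule ccontr)
        assume "Poly_Mapping.keys (r k) \<noteq> {}"
        then obtain m where "m \<in> Poly_Mapping.keys (r k)" by blast
        thus False using lookup_q[of k m] True that by (auto simp: in_keys_iff)
      qed
      thus ?thesis by (simp add: r(2) mpoly_eval_def)
    qed (simp add: coeff_eq_0)
  qed
  ultimately show ?thesis using that by blast
qed

lemma mpolys_mono: "I \<subseteq> J \<Longrightarrow> mpolys K I \<subseteq> mpolys K J"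
  by (auto simp: mpolys_def)

lemma base_in_ring_adjoin:
  assumes "a \<in> K"
  shows "a \<in> ring_adjoin K J x"
proof -
  have "mpoly_eval x (Poly_Mapping.single 0 a) = a"
    by (simp add: mpoly_eval_single power_product_def)
  moreover have "Poly_Mapping.single 0 a \<in> mpolys K J" using assms by (simp add: mpolys_def)
  ultimately show ?thesis unfolding ring_adjoin_def by (metis image_eqI)
qed

lemma gen_in_ring_adjoin:
  assumes "1 \<in> K" "i \<in> J"
  shows "x i \<in> ring_adjoin K J x"
proof -
  let ?p = "Poly_Mapping.single (Poly_Mapping.single i 1) 1"
  have "mpoly_eval x ?p = x i"
    by (simp add: mpoly_eval_single power_product_def)
  moreover have "?p \<in> mpolys K J" using assms by (simp add: mpolys_def)
  ultimately show ?thesis unfolding ring_adjoin_def by (metis image_eqI)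
qed

lemma ring_adjoin_subset:
  assumes S: "subring_set S" and "K \<subseteq> S" "x ` J \<subseteq> S"
  shows "ring_adjoin K J x \<subseteq> S"
proof
  fix a assume "a \<in> ring_adjoin K J x"
  then obtain p where p: "p \<in> mpolys K J" "a = mpoly_eval x p" by (auto simp: ring_adjoin_def)
  show "a \<in> S" unfolding p(2) mpoly_eval_def using p(1) assms(2,3)
    by (intro subring_set_sum[OF S] subring_set_mult[OF S] subring_set_prod[OF S] subring_set_power[OF S])
      (auto simp: mpolys_def image_subset_iff subset_iff)
qed

text \<open>
  A relation for \<open>x i\<close> over the ring generated by the previous indeterminates is a relation between all
  of them. The coefficient ring \<open>A\<close> may be smaller than \<open>K\<close>: this is used with \<open>A = C[W]\<close> inside
  \<open>K = F\<close>, and makes the elements of \<open>W\<close> and the \<open>x i\<close> jointly independent over \<open>C\<close>.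
\<close>

lemma alg_independent_imp_indep_tower:
  assumes AK: "A \<subseteq> K" and indep: "alg_independent K I x"
    and "distinct is" "set is \<subseteq> I"
  shows "poly_tower A (map x is) \<subseteq> ring_adjoin K (set is) x \<and> indep_tower A (map x is)"
  using assms(3,4)
proof (induction "is")
  case Nil
  thus ?case using AK base_in_ring_adjoin[of _ K "{}" x] by auto
next
  case (Cons i "is")
  let ?A = "poly_tower A (map x is)"
  have IH: "?A \<subseteq> ring_adjoin K (set is) x" "indep_tower A (map x is)" and i: "i \<notin> set is"
    using Cons by auto
  have lift: "\<exists>q\<in>mpolys K (set (i # is)). mpoly_eval x q = poly p (x i) \<and> (q = 0 \<longrightarrow> p = 0)"
    if "p \<in> polys_over ?A" for p
  proof -
    have "p \<in> polys_over (ring_adjoin K (set is) x)"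
      using that IH(1) by (auto simp: polys_over_def)
    from poly_over_ring_adjoin[OF this i] show ?thesis by (metis list.simps(15))
  qed
  have "poly_tower A (map x (i # is)) \<subseteq> ring_adjoin K (set (i # is)) x"
  proof
    fix a assume "a \<in> poly_tower A (map x (i # is))"
    then obtain p where "p \<in> polys_over ?A" "a = poly p (x i)" by (auto simp: adjoin_def)
    thus "a \<in> ring_adjoin K (set (i # is)) x" using lift unfolding ring_adjoin_def by (metis image_eqI)
  qed
  moreover have "transcendental_over ?A (x i)"
    unfolding transcendental_over_def
  proof (intro ballI impI)
    fix p assume "p \<in> polys_over ?A" and p0: "poly p (x i) = 0"
    then obtain q where q: "q \<in> mpolys K (set (i # is))" "mpoly_eval x q = 0" "q = 0 \<longrightarrow> p = 0"
      using lift by metis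
    hence "q \<in> mpolys K I" using mpolys_mono[OF Cons.prems(2)] by blast
    thus "p = 0" using q indep unfolding alg_independent_def by blast
  qed
  ultimately show ?case using IH(2) by simp
qed

section \<open>Prime ideals and fractions\<close>

lemma ring_of_type_algebra_simps [simp]:
  "carrier ring_of_type_algebra = UNIV"
  "a \<otimes>\<^bsub>ring_of_type_algebra\<^esub> b = a * b" "a \<oplus>\<^bsub>ring_of_type_algebra\<^esub> b = a + b"
  "\<one>\<^bsub>ring_of_type_algebra\<^esub> = 1" "\<zero>\<^bsub>ring_of_type_algebra\<^esub> = 0"
  by (simp_all add: ring_of_type_algebra_def)

lemma a_inv_ring_of_type_algebra: "\<ominus>\<^bsub>ring_of_type_algebra\<^esub> (a::'a::comm_ring_1) = - a"
proof -
  interpret ring "ring_of_type_algebra :: 'a ring" by (fact ring_from_type_algebra)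
  show ?thesis by (rule minus_equality) simp_all
qed

lemma m_inv_ring_of_type_algebra:
  assumes "(a::'a::field) \<noteq> 0"
  shows "inv\<^bsub>ring_of_type_algebra\<^esub> a = inverse a"
proof -
  interpret cring "ring_of_type_algebra :: 'a ring" by (rule cring_from_type_algebra)
  show ?thesis using assms by (intro comm_inv_char) simp_all
qed

lemma cring_ring_on_iff: "cring (ring_on R) \<longleftrightarrow> subring_set (R::'a::comm_ring_1 set)"
proof -
  interpret cring "ring_of_type_algebra :: 'a ring" by (rule cring_from_type_algebra)
  have "cring (ring_on R) \<longleftrightarrow> subring R ring_of_type_algebra"
    using subcring_iff[of R] subcringI' subcring.axioms(1)
    by auto
  also have "\<dots> \<longleftrightarrow> subring_set R"
  proof
    assume "subring R ring_of_type_algebra"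
    from subringE[OF this] have *: "1 \<in> R" "\<And>a. a \<in> R \<Longrightarrow> - a \<in> R"
      "\<And>a b. a \<in> R \<Longrightarrow> b \<in> R \<Longrightarrow> a * b \<in> R" "\<And>a b. a \<in> R \<Longrightarrow> b \<in> R \<Longrightarrow> a + b \<in> R"
      by (simp_all add: a_inv_ring_of_type_algebra)
    have "a - b \<in> R" if "a \<in> R" "b \<in> R" for a b using *(4)[OF that(1) *(2)[OF that(2)]] by simp
    thus "subring_set R" using * by (simp add: subring_set_def)
  next
    assume R: "subring_set R"
    show "subring R ring_of_type_algebra"
      by (rule subringI)
         (auto simp: a_inv_ring_of_type_algebra intro: subring_setD[OF R])
  qed
  finally show ?thesis .
qed

lemma primeideal_ring_on_iff:
  "primeideal P (ring_on R) \<longleftrightarrow> subring_set (R::'a::comm_ring_1 set) \<and> P \<subseteq> R \<and> 0 \<in> P \<and> 1 \<notin> P \<and>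
    (\<forall>a\<in>P. \<forall>b\<in>P. a + b \<in> P) \<and> (\<forall>r\<in>R. \<forall>a\<in>P. r * a \<in> P) \<and>
    (\<forall>a\<in>R. \<forall>b\<in>R. a * b \<in> P \<longrightarrow> a \<in> P \<or> b \<in> P)" (is "_ \<longleftrightarrow> ?rhs")
proof
  assume P: "primeideal P (ring_on R)"
  then interpret primeideal P "ring_on R" .
  show ?rhs
  proof (intro conjI ballI impI)
    show "subring_set R" using cring_ring_on_iff is_cring by blast
    show "P \<subseteq> R" using a_subset by simp
    show "0 \<in> P" using additive_subgroup.zero_closed[OF is_additive_subgroup] by simp
    show "1 \<notin> P" using I_notcarr one_imp_carrier by auto
    show "a + b \<in> P" if "a \<in> P" "b \<in> P" for a b
      using additive_subgroup.a_closed[OF is_additive_subgroup that]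
      by simp
    show "r * a \<in> P" if "r \<in> R" "a \<in> P" for r a
      using I_l_closed[OF that(2)] that(1) by simp
    show "a \<in> P \<or> b \<in> P" if "a \<in> R" "b \<in> R" "a * b \<in> P" for a b
      using I_prime[of a b] that by simp
  qed
next
  assume rhs: ?rhs
  hence R: "subring_set R" by blast
  interpret cring "ring_on R" using R cring_ring_on_iff by blast
  have "subgroup P (add_monoid (ring_on R))"
  proof (rule add.subgroupI)
    fix a assume a: "a \<in> P"
    have aR: "a \<in> R" using a rhs by blast
    have "- 1 * a \<in> P" using a rhs subring_set_uminus[OF R subring_set_one[OF R]] by blast
    moreover have "\<ominus>\<^bsub>ring_on R\<^esub> a = - a"
      using aR subring_set_uminus[OF R aR] by (intro minus_equality) simp_all
    ultimately show "\<ominus>\<^bsub>ring_on R\<^esub> a \<in> P" by simp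
  qed (use rhs in auto)
  moreover have "a * r \<in> P" if "a \<in> P" "r \<in> R" for a r
    using rhs that by (metis mult.commute)
  ultimately have "ideal P (ring_on R)"
    using rhs by (intro idealI ring_axioms) auto
  thus "primeideal P (ring_on R)"
    using rhs is_cring subring_set_one[OF R] by (intro primeidealI) auto
qed

text \<open>
  A prime ideal of height one in a domain is a minimal nonzero prime ideal: a nonzero prime \<open>P'\<close>
  strictly inside \<open>P\<close> would give the chain \<open>{0} \<subset> P' \<subset> P\<close>.
\<close>

lemma height_one_minimal:
  fixes P :: "'a::idom set"
  assumes P: "primeideal P (ring_on R)" and ht: "ideal_height (ring_on R) P = 1"
  shows "P \<noteq> {0}"
    and "primeideal P' (ring_on R) \<Longrightarrow> P' \<noteq> {0} \<Longrightarrow> P' \<subseteq> P \<Longrightarrow> P' = P"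
proof -
  let ?chain = "\<lambda>k Q. (\<forall>i\<le>k. primeideal (Q i) (ring_on R)) \<and> (\<forall>i<k. Q i \<subset> Q (Suc i)) \<and> Q k = P"
  have R: "subring_set R" using P by (simp add: primeideal_ring_on_iff)
  have zero: "primeideal {0} (ring_on R)"
    using subring_set_zero[OF R] R by (auto simp: primeideal_ring_on_iff)
  show "P \<noteq> {0}"
  proof
    assume P0: "P = {0}"
    have "k = 0" if "?chain k Q" for k Q
    proof (rule ccontr)
      assume "k \<noteq> 0"
      then obtain l where l: "k = Suc l" by (cases k) auto
      have "0 \<in> Q l" using that l by (simp add: primeideal_ring_on_iff)
      moreover have "Q l \<subset> {0}" using that l P0 by auto
      ultimately show False by blast
    qed
    hence "ideal_height (ring_on R) P \<le> 0" unfolding ideal_height_def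
      by (intro SUP_least) (auto simp: zero_enat_def)
    thus False using ht by simp
  qed
  show "P' = P" if P': "primeideal P' (ring_on R)" "P' \<noteq> {0}" "P' \<subseteq> P"
  proof (rule ccontr)
    assume "P' \<noteq> P"
    define Q where "Q i = (if i = 0 then {0} else if i = Suc 0 then P' else P)" for i :: nat
    have "0 \<in> P'" using P' by (simp add: primeideal_ring_on_iff)
    hence "?chain 2 Q" using zero P P' \<open>P' \<noteq> P\<close> unfolding Q_def by (auto simp: less_Suc_eq numeral_2_eq_2)
    hence "enat 2 \<le> ideal_height (ring_on R) P" unfolding ideal_height_def by (intro SUP_upper) blast
    thus False using ht by (simp add: one_enat_def)
  qed
qed

lemma poly_tower_subset:
  assumes S: "subring_set S" and "C \<subseteq> S" "set ys \<subseteq> S"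
  shows "poly_tower C ys \<subseteq> S"
  using assms(3)
proof (induction ys)
  case (Cons y ys)
  show ?case
  proof
    fix a assume "a \<in> poly_tower C (y # ys)"
    then obtain p where p: "p \<in> polys_over (poly_tower C ys)" "a = poly p y"
      by (auto simp: adjoin_def)
    have "poly_tower C ys \<subseteq> S" using Cons by simp
    hence "coeff p i \<in> S" for i using polys_overD[OF p(1)] by blast
    thus "a \<in> S" unfolding p(2) using Cons.prems by (intro poly_in_subring[OF S]) auto
  qed
qed (use assms in auto)

lemma field_adjoin_fraction:
  fixes C :: "'a::field set"
  assumes C: "subring_set C" and W: "set ws = W" and f: "f \<in> field_adjoin C W"
  obtains a b where "a \<in> poly_tower C ws" "b \<in> poly_tower C ws" "b \<noteq> 0" "f = a / b"
proof -
  note A = subring_poly_tower[OF C, of ws]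
  from f have "\<exists>a b. a \<in> poly_tower C ws \<and> b \<in> poly_tower C ws \<and> b \<noteq> 0 \<and> f = a / b"
  proof (induction rule: generate_field.induct)
    case one
    show ?case using subring_set_one[OF A]
      by (intro exI[of _ 1]) simp
  next
    case (incl h)
    hence "h \<in> poly_tower C ws"
      using base_subset_poly_tower[OF C, of ws] gens_subset_poly_tower[OF C, of ws] W by auto
    thus ?case using subring_set_one[OF A] by (intro exI[of _ h] exI[of _ 1]) simp
  next
    case (a_inv h)
    then obtain a b where "a \<in> poly_tower C ws" "b \<in> poly_tower C ws" "b \<noteq> 0" "h = a / b" by blast
    thus ?case using subring_set_uminus[OF A]
      by (intro exI[of _ "- a"] exI[of _ b]) (simp add: a_inv_ring_of_type_algebra)
  next
    case (m_inv h)
    then obtain a b where "a \<in> poly_tower C ws" "b \<in> poly_tower C ws" "b \<noteq> 0" "h = a / b" by blast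
    thus ?case using m_inv.hyps(2)
      by (intro exI[of _ b] exI[of _ a])
         (auto simp: m_inv_ring_of_type_algebra)
  next
    case (eng_add h1 h2)
    then obtain a b c d where "a \<in> poly_tower C ws" "b \<in> poly_tower C ws" "b \<noteq> 0" "h1 = a / b"
      "c \<in> poly_tower C ws" "d \<in> poly_tower C ws" "d \<noteq> 0" "h2 = c / d" by blast
    thus ?case using subring_set_mult[OF A] subring_set_add[OF A]
      by (intro exI[of _ "a * d + c * b"] exI[of _ "b * d"])
         (auto simp: field_simps)
  next
    case (eng_mult h1 h2)
    then obtain a b c d where "a \<in> poly_tower C ws" "b \<in> poly_tower C ws" "b \<noteq> 0" "h1 = a / b"
      "c \<in> poly_tower C ws" "d \<in> poly_tower C ws" "d \<noteq> 0" "h2 = c / d" by blast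
    thus ?case using subring_set_mult[OF A]
      by (intro exI[of _ "a * c"] exI[of _ "b * d"])
         auto
  qed
  thus ?thesis using that by blast
qed

lemma field_adjoin_closed:
  fixes C :: "'a::field set"
  shows subring_field_adjoin: "subring_set (field_adjoin C W)"
    and inverse_field_adjoin: "f \<in> field_adjoin C W \<Longrightarrow> inverse f \<in> field_adjoin C W"
proof -
  let ?F = "field_adjoin C W"
  have F_one: "1 \<in> ?F"
    using generate_field.one[of ring_of_type_algebra "C \<union> W"] by simp
  have mult: "a * b \<in> ?F" and add: "a + b \<in> ?F" if "a \<in> ?F" "b \<in> ?F" for a b
    using generate_field.eng_mult[OF that] generate_field.eng_add[OF that]
    by simp_all
  have uminus: "- a \<in> ?F" if "a \<in> ?F" for a
    using generate_field.a_inv[OF that] by (simp add: a_inv_ring_of_type_algebra)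
  have "a - b \<in> ?F" if "a \<in> ?F" "b \<in> ?F" for a b using add[OF that(1) uminus[OF that(2)]] by simp
  thus "subring_set ?F" using F_one mult by (auto simp: subring_set_def)
  show "inverse f \<in> ?F" if "f \<in> ?F"
    using generate_field.m_inv[OF that] that
    by (cases "f = 0") (auto simp: m_inv_ring_of_type_algebra)
qed

section \<open>Height one differential primes\<close>

text \<open>
  \<open>R\<close> is the localization of \<open>B\<close> at the nonzero elements of \<open>A\<close>. The contraction of \<open>P\<close> to \<open>B\<close>
  contains a prime element \<open>p\<close>, which divides no denominator because \<open>p\<close> lies in \<open>P\<close> and denominators are units of \<open>R\<close>. So \<open>p\<close>
  still generates a prime ideal of \<open>R\<close>, and that ideal is all of \<open>P\<close> by minimality; moreover the
  contraction of \<open>P\<close> is the ideal of \<open>B\<close> generated by \<open>p\<close>.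
\<close>

lemma localized_height_one_prime:
  fixes A B R :: "'e::field set"
  assumes ufd: "ufd_set B" and R: "subring_set R" and BR: "B \<subseteq> R"
    and AB: "A \<subseteq> B" and A_mult: "\<And>s t. s \<in> A \<Longrightarrow> t \<in> A \<Longrightarrow> s * t \<in> A"
    and A_inv: "\<And>s. s \<in> A \<Longrightarrow> inverse s \<in> R"
    and denom: "\<And>r. r \<in> R \<Longrightarrow> \<exists>s\<in>A. s \<noteq> 0 \<and> s * r \<in> B"
    and P: "primeideal P (ring_on R)" and ht: "ideal_height (ring_on R) P = 1"
  shows "\<exists>p. prime_in B p \<and> p \<in> P \<and> P = (*) p ` R \<and> (\<forall>b\<in>B \<inter> P. dvd_in B p b)"
proof -
  have B: "subring_set B" using ufd by (simp add: ufd_set_def)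
  have PR: "P \<subseteq> R" and P0: "0 \<in> P" and P1: "1 \<notin> P"
    and P_mult: "\<And>r a. r \<in> R \<Longrightarrow> a \<in> P \<Longrightarrow> r * a \<in> P"
    and P_prime: "\<And>a b. a \<in> R \<Longrightarrow> b \<in> R \<Longrightarrow> a * b \<in> P \<Longrightarrow> a \<in> P \<or> b \<in> P"
    using P by (simp_all add: primeideal_ring_on_iff)
  have "P \<noteq> {0}" using height_one_minimal(1)[OF P ht] .
  then obtain e where e: "e \<in> P" "e \<noteq> 0" using P0 by blast
  obtain s where s: "s \<in> A" "s \<noteq> 0" "s * e \<in> B" using denom e(1) PR by blast
  have sP: "s * e \<in> P" using P_mult e(1) s(1) AB BR by blast
  obtain p where p: "prime_in B p" "p \<in> P"
  proof (rule prime_ideal_contains_prime[OF ufd s(3) sP])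
    show "s * e \<noteq> 0" using s e by simp
    show "u \<notin> P" if "u \<in> B" "dvd_in B u 1" for u
      using that P_mult P1 BR unfolding dvd_in_def by (metis mult.commute subsetD)
    show "a \<in> P \<or> b \<in> P" if "a \<in> B" "b \<in> B" "a * b \<in> P" for a b
      using P_prime that BR by blast
  qed
  note p_in = prime_inD(1)[OF p(1)]
  have p_nz: "p \<noteq> 0" using prime_inD(2)[OF p(1)] .
  have denom_coprime: "\<not> dvd_in B p s" if "s \<in> A" "s \<noteq> 0" for s
  proof
    assume "dvd_in B p s"
    then obtain c where "c \<in> B" "s = p * c" by (auto simp: dvd_in_def)
    hence "s \<in> P" using P_mult p(2) BR by (metis mult.commute subsetD)
    hence "inverse s * s \<in> P" using P_mult A_inv[OF that(1)] by blast
    thus False using that(2) P1 by simp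
  qed
  have dvdI: "dvd_in B p b" if b: "b \<in> B" and pb: "b \<in> (*) p ` R" for b
  proof -
    obtain r where r: "r \<in> R" "b = p * r" using pb by auto
    obtain s where s: "s \<in> A" "s \<noteq> 0" "s * r \<in> B" using denom[OF r(1)] by blast
    have "dvd_in B p (s * b)"
      using dvd_in_triv[OF B s(3), of p] by (simp add: r(2) ac_simps)
    thus ?thesis using prime_inD(4)[OF p(1) _ b] s(1) AB denom_coprime[OF s(1,2)] by blast
  qed
  have p_mult: "a * r \<in> (*) p ` R" if "r \<in> R" "a \<in> (*) p ` R" for a r
    using that subring_set_mult[OF R] by (auto simp: mult.assoc)
  have "primeideal ((*) p ` R) (ring_on R)"
    unfolding primeideal_ring_on_iff
  proof (intro conjI ballI impI)
    show "subring_set R" by fact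
    show "(*) p ` R \<subseteq> R" using subring_set_mult[OF R] p_in BR by blast
    show "0 \<in> (*) p ` R" using subring_set_zero[OF R] by force
    show "1 \<notin> (*) p ` R"
    proof
      assume "1 \<in> (*) p ` R"
      then obtain r where "r \<in> R" "1 = r * p" by (auto simp: mult.commute)
      thus False using P_mult[OF _ p(2)] P1 by metis
    qed
    show "a + b \<in> (*) p ` R" if "a \<in> (*) p ` R" "b \<in> (*) p ` R" for a b
      using that subring_set_add[OF R] by (auto simp: distrib_left[symmetric])
    show "r * a \<in> (*) p ` R" if "r \<in> R" "a \<in> (*) p ` R" for r a
      using p_mult[OF that] by (simp add: mult.commute)
    fix a b assume a: "a \<in> R" and b: "b \<in> R" and ab: "a * b \<in> (*) p ` R"
    obtain s where s: "s \<in> A" "s \<noteq> 0" "s * a \<in> B" using denom[OF a] by blast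
    obtain t where t: "t \<in> A" "t \<noteq> 0" "t * b \<in> B" using denom[OF b] by blast
    have "(a * b) * (s * t) \<in> (*) p ` R"
      using p_mult[OF _ ab] A_mult[OF s(1) t(1)] AB BR by blast
    hence "(s * a) * (t * b) \<in> (*) p ` R" by (simp add: ac_simps)
    hence "dvd_in B p ((s * a) * (t * b))" by (intro dvdI subring_set_mult[OF B] s t)
    hence "dvd_in B p (s * a) \<or> dvd_in B p (t * b)" by (rule prime_inD(4)[OF p(1) s(3) t(3)])
    moreover have "c \<in> (*) p ` R" if "dvd_in B p (w * c)" "w \<in> A" "w \<noteq> 0" for w c
    proof -
      from that(1) obtain d where d: "d \<in> B" "w * c = p * d" by (auto simp: dvd_in_def)
      have "c = p * (d * inverse w)" using d(2) that(3) by (simp add: field_simps)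
      thus ?thesis using subring_set_mult[OF R] A_inv[OF that(2)] d(1) BR by blast
    qed
    ultimately show "a \<in> (*) p ` R \<or> b \<in> (*) p ` R" using s t by blast
  qed
  moreover have "(*) p ` R \<noteq> {0}"
    using p_nz subring_set_one[OF R] by (metis image_eqI mult_1_right singletonD)
  moreover have "(*) p ` R \<subseteq> P" using P_mult[OF _ p(2)] by (auto simp: mult.commute)
  ultimately have PpR: "P = (*) p ` R" using height_one_minimal(2)[OF P ht] by blast
  thus ?thesis using p dvdI by blast
qed

theorem theorem2p5:
  fixes D :: "'e::field_char_0 \<Rightarrow> 'e"
    and F C T W R :: "'e set"
    and C' :: "rat alg_closure set"
    and \<iota> :: "rat alg_closure \<Rightarrow> 'e"
    and x :: "nat \<Rightarrow> 'e"
    and n :: nat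
  assumes D: "derivation D"
    and F: "subfield F ring_of_type_algebra" "D_stable D F"
    and C: "C = constants D F"
    and W: "finite W" "alg_independent_set C W" "F = field_adjoin C W"
    and C': "subfield C' ring_of_type_algebra"
    and \<iota>: "\<iota> \<in> ring_hom (ring_on C') ring_of_type_algebra"
    and T: "alg_independent_set (\<iota> ` C') T" "C = field_adjoin (\<iota> ` C') T"
    and R: "is_polynomial_ring R F n x" "D_stable D R"
    and E: "whole_is_quotient_field_of R"
    and no_new_constants: "constants D UNIV = C"
  shows "finite {P. primeideal P (ring_on R) \<and> ideal_height (ring_on R) P = 1 \<and> D_stable D P}"
    (is "finite ?HP")
proof (cases "?HP = {}")
  case True
  show ?thesis unfolding True by simp
next
  case False
  then obtain P0 where "primeideal P0 (ring_on R)" by blast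
  hence R_subring: "subring_set R" by (simp add: primeideal_ring_on_iff)
  have C_iff: "c \<in> C \<longleftrightarrow> D c = 0" for c using no_new_constants by (auto simp: constants_def)
  have C_subring: "subring_set C"
    by (auto simp: subring_set_def C_iff derivationD[OF D])
  have C_inv: "inverse c \<in> C" if "c \<in> C" for c
    using that derivation_divide[OF D, of c 1]
    by (cases "c = 0") (auto simp: C_iff derivationD[OF D] inverse_eq_divide)
  have F_subring: "subring_set F" and F_inv: "\<And>f. f \<in> F \<Longrightarrow> inverse f \<in> F"
    unfolding W(3) by (rule subring_field_adjoin, rule inverse_field_adjoin)
  have CF: "C \<subseteq> F" using C by (auto simp: constants_def)
  have WF: "W \<subseteq> F" unfolding W(3) by (auto intro!: generate_field.incl)
  have R_eq: "R = ring_adjoin F {1..n} x" and indep_x: "alg_independent F {1..n} x"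
    using R(1) by (auto simp: is_polynomial_ring_def)
  have FR: "F \<subseteq> R" unfolding R_eq using base_in_ring_adjoin by blast
  have xR: "x i \<in> R" if "i \<in> {1..n}" for i
    unfolding R_eq using subring_set_one[OF F_subring] that by (rule gen_in_ring_adjoin)

  obtain ws where ws: "set ws = W" "distinct ws" using finite_distinct_list[OF W(1)] by blast
  define xs where "xs = map x [1..<Suc n]"
  define ys where "ys = xs @ ws"
  define A where "A = poly_tower C ws"
  define B where "B = poly_tower C ys"
  have B_eq: "B = poly_tower A xs" by (simp add: B_def ys_def A_def poly_tower_append)
  have A_subring: "subring_set A" and B_subring: "subring_set B"
    unfolding A_def B_def by (rule subring_poly_tower[OF C_subring])+
  have set_xs: "set xs = x ` {1..n}" by (auto simp: xs_def)
  have AF: "A \<subseteq> F" unfolding A_def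
    using ws(1) WF CF by (intro poly_tower_subset[OF F_subring]) auto
  have AB: "A \<subseteq> B" unfolding B_eq by (rule base_subset_poly_tower[OF A_subring])
  have xB: "x i \<in> B" if "i \<in> {1..n}" for i
    unfolding B_eq using gens_subset_poly_tower[OF A_subring, of xs] set_xs that by blast
  have BR: "B \<subseteq> R" unfolding B_eq
    using AF FR xR set_xs by (intro poly_tower_subset[OF R_subring]) auto
  have indep: "indep_tower C ys"
  proof -
    have "indep_tower C (map (\<lambda>w. w) ws)"
      using alg_independent_imp_indep_tower[OF subset_refl W(2) ws(2)] ws(1) by blast
    moreover have "indep_tower A xs"
    proof -
      have "set [1..<Suc n] \<subseteq> {1..n}" by auto
      from alg_independent_imp_indep_tower[OF AF indep_x distinct_upt this] show ?thesis
        unfolding xs_def by blast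
    qed
    ultimately show ?thesis by (simp add: ys_def indep_tower_append A_def)
  qed
  interpret tower: indeterminates C ys
    by unfold_locales (fact C_subring, fact C_inv, fact indep)

  \<comment> \<open>The elements that become polynomials after multiplication by a nonzero \<open>s\<close> of \<open>A = C[W]\<close> form a ring.\<close>
  have denom: "\<exists>s\<in>A. s \<noteq> 0 \<and> s * r \<in> B" if "r \<in> R" for r
  proof -
    let ?L = "{r. \<exists>s\<in>A. s \<noteq> 0 \<and> s * r \<in> B}"
    have "subring_set ?L"
      unfolding subring_set_def
    proof (intro conjI ballI)
      show "1 \<in> ?L" using subring_set_one[OF A_subring] AB by (auto intro!: bexI[of _ 1])
      fix a b assume "a \<in> ?L" "b \<in> ?L"
      then obtain s t where st: "s \<in> A" "s \<noteq> 0" "s * a \<in> B" "t \<in> A" "t \<noteq> 0" "t * b \<in> B" by blast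
      have st': "s * t \<in> A" "s * t \<noteq> 0" using st subring_set_mult[OF A_subring] by auto
      have "(s * a) * (t * b) \<in> B" using subring_set_mult[OF B_subring] st by blast
      hence "(s * t) * (a * b) \<in> B" by (simp add: ac_simps)
      thus "a * b \<in> ?L" using st' by blast
      have "t * (s * a) - s * (t * b) \<in> B"
        using subring_set_mult[OF B_subring] subring_set_diff[OF B_subring] st AB by blast
      hence "(s * t) * (a - b) \<in> B" by (simp add: algebra_simps)
      thus "a - b \<in> ?L" using st' by blast
    qed
    moreover have "F \<subseteq> ?L"
    proof
      fix f assume "f \<in> F"
      then obtain a b where "a \<in> A" "b \<in> A" "b \<noteq> 0" "f = a / b"
        unfolding W(3) A_def by (rule field_adjoin_fraction[OF C_subring ws(1)])
      thus "f \<in> ?L" using AB by (auto intro!: bexI[of _ b])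
    qed
    moreover have "x ` {1..n} \<subseteq> ?L"
      using xB subring_set_one[OF A_subring] by (auto intro!: bexI[of _ 1])
    ultimately show ?thesis using ring_adjoin_subset[of ?L F x "{1..n}"] that R_eq by blast
  qed

  have D_gen: "D y \<in> R" if "y \<in> set ys" for y
    using that R(2) tower.gen_in_B[OF that] BR unfolding D_stable_def B_def by blast
  obtain s where s: "\<And>y. y \<in> set ys \<Longrightarrow> s y \<in> A \<and> s y \<noteq> 0 \<and> s y * D y \<in> B"
    using denom[OF D_gen] by metis
  \<comment> \<open>A common denominator of the derivatives of all indeterminates.\<close>
  define g where "g = prod s (set ys)"
  have g: "g \<in> A" "g \<noteq> 0"
    unfolding g_def using s subring_set_prod[OF A_subring, of "set ys" s] by auto
  define \<delta> where "\<delta> e = g * D e" for e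
  have \<delta>: "derivation \<delta>"
    by (simp add: derivation_def \<delta>_def derivation_add[OF D] derivation_mult[OF D] algebra_simps)
  have \<delta>_gen: "\<delta> y \<in> B" if y: "y \<in> set ys" for y
  proof -
    have "g = s y * prod s (set ys - {y})" unfolding g_def using y by (intro prod.remove) auto
    hence "\<delta> y = prod s (set ys - {y}) * (s y * D y)" by (simp add: \<delta>_def)
    also have "\<dots> \<in> B"
    proof (rule subring_set_mult[OF B_subring])
      show "prod s (set ys - {y}) \<in> B" using s AB by (intro subring_set_prod[OF B_subring]) auto
      show "s y * D y \<in> B" using s y by blast
    qed
    finally show ?thesis .
  qed
  have \<delta>B: "\<delta> ` B \<subseteq> B"
  proof (rule image_subsetI)
    fix b assume "b \<in> B"
    thus "\<delta> b \<in> B" unfolding B_def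
    proof (induction rule: tower.B_induct)
      case (base c)
      thus ?case using C_iff subring_set_zero[OF B_subring] by (simp add: \<delta>_def B_def)
    next
      case (gen y)
      thus ?case using \<delta>_gen by (simp add: B_def)
    next
      case (add a b)
      thus ?case using subring_set_add[OF B_subring] by (simp add: derivation_add[OF \<delta>] B_def)
    next
      case (mult a b)
      thus ?case using subring_set_add[OF B_subring] subring_set_mult[OF B_subring]
        by (simp add: derivation_mult[OF \<delta>] B_def)
    qed
  qed
  have "constants \<delta> UNIV = C" using g(2) by (auto simp: constants_def \<delta>_def C_iff)
  then obtain N where N: "\<And>S. finite S \<Longrightarrow> (\<And>p. p \<in> S \<Longrightarrow> prime_in B p \<and> dvd_in B p (\<delta> p)) \<Longrightarrow>
      (\<And>p q. p \<in> S \<Longrightarrow> q \<in> S \<Longrightarrow> p \<noteq> q \<Longrightarrow> \<not> dvd_in B p q) \<Longrightarrow> card S \<le> N"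
    using tower.finitely_many_invariant_primes[OF \<delta> \<delta>B[unfolded B_def]] unfolding B_def by blast

  define \<H> where "\<H> = ?HP"
  have "\<exists>p. prime_in B p \<and> dvd_in B p (\<delta> p) \<and> P = (*) p ` R" if P: "P \<in> \<H>" for P
  proof -
    have prime: "primeideal P (ring_on R)" and ht: "ideal_height (ring_on R) P = 1"
      and DP: "D_stable D P" using P by (auto simp: \<H>_def)
    have "\<exists>p. prime_in B p \<and> p \<in> P \<and> P = (*) p ` R \<and> (\<forall>b\<in>B \<inter> P. dvd_in B p b)"
    proof (rule localized_height_one_prime[OF _ R_subring BR AB _ _ denom prime ht])
      show "ufd_set B" unfolding B_def by (rule ufd_poly_tower[OF C_subring C_inv indep])
      show "s * t \<in> A" if "s \<in> A" "t \<in> A" for s t using subring_set_mult[OF A_subring that] .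
      show "inverse s \<in> R" if "s \<in> A" for s using that AF F_inv FR by blast
    qed
    then obtain p where p: "prime_in B p" "p \<in> P" "P = (*) p ` R" "\<forall>b\<in>B \<inter> P. dvd_in B p b"
      by blast
    have "D p \<in> P" using DP p(2) by (auto simp: D_stable_def)
    hence "\<delta> p \<in> P" using prime g(1) AB BR by (auto simp: \<delta>_def primeideal_ring_on_iff)
    moreover have "\<delta> p \<in> B" using \<delta>B prime_inD(1)[OF p(1)] by blast
    ultimately show ?thesis using p by blast
  qed
  hence "\<forall>P\<in>\<H>. \<exists>p. prime_in B p \<and> dvd_in B p (\<delta> p) \<and> P = (*) p ` R" by blast
  then obtain f where "\<forall>P\<in>\<H>. prime_in B (f P) \<and> dvd_in B (f P) (\<delta> (f P)) \<and> P = (*) (f P) ` R"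
    by (rule bchoice[THEN exE])
  hence f: "prime_in B (f P)" "dvd_in B (f P) (\<delta> (f P))" "(*) (f P) ` R = P" if "P \<in> \<H>" for P
    using that by blast+
  have f_dvd: "P = Q" if PQ: "P \<in> \<H>" "Q \<in> \<H>" and dvd: "dvd_in B (f P) (f Q)" for P Q
  proof -
    obtain c where c: "c \<in> B" "f Q = f P * c" using dvd by (auto simp: dvd_in_def)
    have "(*) (f Q) ` R \<subseteq> (*) (f P) ` R"
      using c subring_set_mult[OF R_subring] BR by (auto simp: mult.assoc)
    hence "Q \<subseteq> P" unfolding f(3)[OF PQ(1)] f(3)[OF PQ(2)] .
    have P: "primeideal P (ring_on R)" "ideal_height (ring_on R) P = 1"
      and Q: "primeideal Q (ring_on R)" "ideal_height (ring_on R) Q = 1"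
      using PQ by (simp_all add: \<H>_def)
    from height_one_minimal(2)[OF P Q(1) height_one_minimal(1)[OF Q] \<open>Q \<subseteq> P\<close>] show ?thesis by simp
  qed
  have "finite \<H>"
  proof (rule ccontr)
    assume "infinite \<H>"
    then obtain \<P> where \<P>: "\<P> \<subseteq> \<H>" "finite \<P>" "card \<P> = Suc N"
      using infinite_arbitrarily_large by blast
    have "inj_on f \<P>"
    proof (rule inj_onI)
      fix P Q assume PQ: "P \<in> \<P>" "Q \<in> \<P>" "f P = f Q"
      have "P \<in> \<H>" "Q \<in> \<H>" using PQ(1,2) \<P>(1) by blast+
      thus "P = Q" by (rule f_dvd) (simp add: PQ(3) dvd_in_refl[OF B_subring])
    qed
    hence "card (f ` \<P>) = Suc N" using \<P>(3) by (simp add: card_image)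
    moreover have "card (f ` \<P>) \<le> N"
    proof (rule N)
      show "finite (f ` \<P>)" using \<P>(2) by simp
      show "prime_in B p \<and> dvd_in B p (\<delta> p)" if "p \<in> f ` \<P>" for p
        using that \<P>(1) f(1,2) by blast
      show "\<not> dvd_in B p q" if "p \<in> f ` \<P>" "q \<in> f ` \<P>" "p \<noteq> q" for p q
        using that \<P>(1) f_dvd by blast
    qed
    ultimately show False by simp
  qed
  thus ?thesis by (simp add: \<H>_def)
qed

end
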